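(* Let $U$ and $X$ be finite-dimensional inner product spaces, let $A\in\mathcal{L}(X)$ and $B\in\mathcal{L}(U,X)$ be linear maps, and let $f\colon X\to X$ be given by $f(x)=\Gamma(x,x)$ for a symmetric bilinear map $\Gamma\colon X\times X\to X$. Define recursively $E_0:=\operatorname{Range}(B)$ and $E_i:=\mathscr{F}(E_{i-1})$ for $i\geq 1$ (with $\mathscr{F}$ as defined in the context), and assume that there exists $n_X\in\mathbb{N}$ such that $E_{n_X}=X$. Let $\tau>0$. Given any $\psi\in W^{1,2}((0,\tau);X)$ and $\varepsilon>0$, there exists a control $u\in C^\infty([0,\tau];U)$ such that the corresponding solution $x$ of $$\dot{x}(t)+Ax(t)+f(x(t))=Bu(t)\quad (t\in[0,\tau]),\qquad x(0)=\psi(0),$$ (exists on $[0,\tau]$ and) satisfies $$|x(\tau)-\psi(\tau)|+|||x-\psi|||_\tau<\varepsilon .$$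
   Context: $|\cdot|$ denotes the norm of $X$. For $\tau>0$ and $v\in L^1([0,\tau];X)$, the relaxation norm is $$|||v|||_\tau:=\sup_{t\in[0,\tau]}\left\|\int_0^t v(s)\,\mathrm{d}s\right\|_X .$$ Given a subspace $E\subset X$, $\mathscr{F}(E)$ denotes the largest subspace of $X$ such that every $\gamma\in\mathscr{F}(E)$ can be expressed as $\gamma=\xi_0-\sum_{i=1}^p f(\xi_i)$ for some $p\in\mathbb{N}$ and $\xi_0,\xi_1,\dots,\xi_p\in E$. No assumption excludes finite-time blowup of the uncontrolled dynamics; that the controlled solution is defined on all of $[0,\tau]$ is part of the assertion. *)

theory Defs
  imports "HOL-Analysis.Analysis"
begin

text \<open>
  For \<open>S = {0..\<tau>}\<close> with \<open>\<tau> > 0\<close> the derivatives at the end points are one-sided, so that this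
  is \<open>C\<^sup>\<infinity>([0,\<tau>])\<close>; for \<open>S = UNIV\<close> it is \<open>C\<^sup>\<infinity>(\<real>)\<close>.  \<open>D k\<close> is the \<open>k\<close>-th derivative of \<open>g\<close>.
\<close>

definition C_infinity_on :: "real set \<Rightarrow> (real \<Rightarrow> 'a::real_normed_vector) \<Rightarrow> bool"
  where "C_infinity_on S g \<longleftrightarrow>
    (\<exists>D :: nat \<Rightarrow> real \<Rightarrow> 'a.
       (\<forall>t\<in>S. D 0 t = g t) \<and>
       (\<forall>k. \<forall>t\<in>S. (D k has_vector_derivative D (Suc k) t) (at t within S)))"

definition test_function :: "real set \<Rightarrow> (real \<Rightarrow> real) \<Rightarrow> bool"
  where "test_function I \<phi> \<longleftrightarrow>
    C_infinity_on UNIV \<phi> \<and>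
    compact (closure {t. \<phi> t \<noteq> 0}) \<and> closure {t. \<phi> t \<noteq> 0} \<subseteq> I"

definition L2_on :: "real set \<Rightarrow> (real \<Rightarrow> 'a::euclidean_space) \<Rightarrow> bool"
  where "L2_on I g \<longleftrightarrow>
    set_borel_measurable lebesgue I g \<and>
    set_integrable lebesgue I (\<lambda>t. (norm (g t))\<^sup>2)"

definition weak_derivative_on ::
  "real set \<Rightarrow> (real \<Rightarrow> 'a::euclidean_space) \<Rightarrow> (real \<Rightarrow> 'a) \<Rightarrow> bool"
  where "weak_derivative_on I \<psi> g \<longleftrightarrow>
    (\<forall>\<phi>. test_function I \<phi> \<longrightarrow>
       (LINT t:I|lebesgue. deriv \<phi> t *\<^sub>R \<psi> t) = - (LINT t:I|lebesgue. \<phi> t *\<^sub>R g t))"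

text \<open>
  Membership in \<open>W\<^sup>1\<^sup>,\<^sup>2(I)\<close> for an open interval \<open>I\<close> depends only on the a.e. class of \<open>\<psi>\<close> on \<open>I\<close>.
  Point values refer to the continuous representative on the closure of \<open>I\<close>, so a statement
  that evaluates \<open>\<psi>\<close> at points has to assume additionally that \<open>\<psi>\<close> is continuous there.
\<close>

definition Sobolev_W12 :: "real set \<Rightarrow> (real \<Rightarrow> 'a::euclidean_space) set"
  where "Sobolev_W12 I = {\<psi>. L2_on I \<psi> \<and> (\<exists>g. L2_on I g \<and> weak_derivative_on I \<psi> g)}"

definition relaxation_norm :: "real \<Rightarrow> (real \<Rightarrow> 'a::euclidean_space) \<Rightarrow> real"
  where "relaxation_norm \<tau> v = (SUP t\<in>{0..\<tau>}. norm (LINT s:{0..t}|lebesgue. v s))"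

definition representable :: "('a::real_vector \<Rightarrow> 'a) \<Rightarrow> 'a set \<Rightarrow> 'a \<Rightarrow> bool"
  where "representable f E \<gamma> \<longleftrightarrow>
    (\<exists>(p::nat) (\<xi> :: nat \<Rightarrow> 'a). (\<forall>i\<le>p. \<xi> i \<in> E) \<and> \<gamma> = \<xi> 0 - (\<Sum>i=1..p. f (\<xi> i)))"

text \<open>
  \<open>GREATEST\<close> is with respect to inclusion.  That a greatest such subspace exists if \<open>f\<close> is
  quadratic and \<open>E\<close> is a subspace is shown below.
\<close>

definition script_F :: "('a::real_vector \<Rightarrow> 'a) \<Rightarrow> 'a set \<Rightarrow> 'a set"
  where "script_F f E = (GREATEST F. subspace F \<and> (\<forall>\<gamma>\<in>F. representable f E \<gamma>))"

primrec E_space :: "('x::real_vector \<Rightarrow> 'x) \<Rightarrow> ('u \<Rightarrow> 'x) \<Rightarrow> nat \<Rightarrow> 'x set"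
  where
    "E_space f B 0 = range B"
  | "E_space f B (Suc i) = script_F f (E_space f B i)"

definition controlled_solution ::
  "('x::real_normed_vector \<Rightarrow> 'x) \<Rightarrow> ('x \<Rightarrow> 'x) \<Rightarrow> ('u \<Rightarrow> 'x) \<Rightarrow> real \<Rightarrow> 'x \<Rightarrow>
   (real \<Rightarrow> 'u) \<Rightarrow> (real \<Rightarrow> 'x) \<Rightarrow> bool"
  where "controlled_solution A f B \<tau> x0 u x \<longleftrightarrow>
    x 0 = x0 \<and>
    (\<forall>t\<in>{0..\<tau>}. \<exists>x'. (x has_vector_derivative x') (at t within {0..\<tau>}) \<and>
       x' + A (x t) + f (x t) = B (u t))"

lemma representable_add:
  assumes "subspace E" "representable f E a" "representable f E b"
  shows "representable f E (a + b)"
proof -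
  obtain p :: nat and \<xi> where 1: "\<And>i. i \<le> p \<Longrightarrow> \<xi> i \<in> E" "a = \<xi> 0 - (\<Sum>i=1..p. f (\<xi> i))"
    using assms(2) unfolding representable_def by blast
  obtain q :: nat and \<eta> where 2: "\<And>i. i \<le> q \<Longrightarrow> \<eta> i \<in> E" "b = \<eta> 0 - (\<Sum>i=1..q. f (\<eta> i))"
    using assms(3) unfolding representable_def by blast
  define \<zeta> where
    "\<zeta> = (\<lambda>i. if i = 0 then \<xi> 0 + \<eta> 0 else if i \<le> p then \<xi> i else \<eta> (i - p))"
  have "\<zeta> i \<in> E" if "i \<le> p + q" for i
    using that 1(1) 2(1) assms(1) by (auto simp: \<zeta>_def subspace_add)
  moreover have "(\<Sum>i=1..p+q. f (\<zeta> i)) = (\<Sum>i=1..p. f (\<xi> i)) + (\<Sum>i=1..q. f (\<eta> i))"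
  proof -
    have "(\<Sum>i=1..p+q. f (\<zeta> i)) = (\<Sum>i=1..p. f (\<zeta> i)) + (\<Sum>i=p+1..p+q. f (\<zeta> i))"
      by (rule sum.ub_add_nat) simp
    also have "(\<Sum>i=1..p. f (\<zeta> i)) = (\<Sum>i=1..p. f (\<xi> i))"
      by (intro sum.cong) (auto simp: \<zeta>_def)
    also have "(\<Sum>i=p+1..p+q. f (\<zeta> i)) = (\<Sum>i=1..q. f (\<zeta> (i + p)))"
      using sum.shift_bounds_cl_nat_ivl[of "\<lambda>i. f (\<zeta> i)" 1 p q] by (simp add: add.commute)
    also have "\<dots> = (\<Sum>i=1..q. f (\<eta> i))"
      by (intro sum.cong) (auto simp: \<zeta>_def)
    finally show ?thesis .
  qed
  ultimately show ?thesis
    unfolding representable_def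
    by (intro exI[of _ "p + q"] exI[of _ \<zeta>]) (simp add: 1(2) 2(2) \<zeta>_def)
qed

lemma representable_scale:
  assumes "subspace E" "representable f E a" "0 \<le> c"
    and "\<And>r x. f (r *\<^sub>R x) = r\<^sup>2 *\<^sub>R f x"
  shows "representable f E (c *\<^sub>R a)"
proof -
  obtain p :: nat and \<xi> where 1: "\<And>i. i \<le> p \<Longrightarrow> \<xi> i \<in> E" "a = \<xi> 0 - (\<Sum>i=1..p. f (\<xi> i))"
    using assms(2) unfolding representable_def by blast
  define \<zeta> where "\<zeta> = (\<lambda>i. if i = 0 then c *\<^sub>R \<xi> 0 else sqrt c *\<^sub>R \<xi> i)"
  have "\<zeta> i \<in> E" if "i \<le> p" for i
    using that 1(1) assms(1) by (auto simp: \<zeta>_def subspace_scale)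
  moreover have "(\<Sum>i=1..p. f (\<zeta> i)) = c *\<^sub>R (\<Sum>i=1..p. f (\<xi> i))"
    unfolding scaleR_sum_right using assms(3,4) by (intro sum.cong) (auto simp: \<zeta>_def)
  ultimately show ?thesis
    unfolding representable_def
    by (intro exI[of _ p] exI[of _ \<zeta>]) (simp add: 1(2) \<zeta>_def scaleR_diff_right)
qed

lemma script_F_greatest:
  assumes "bilinear \<Gamma>" "\<And>x. f x = \<Gamma> x x" "subspace E"
  shows "subspace (script_F f E)"
    and "\<gamma> \<in> script_F f E \<Longrightarrow> representable f E \<gamma>"
    and "subspace G \<Longrightarrow> (\<And>\<gamma>. \<gamma> \<in> G \<Longrightarrow> representable f E \<gamma>) \<Longrightarrow> G \<subseteq> script_F f E"
proof -
  have hom: "f (r *\<^sub>R x) = r\<^sup>2 *\<^sub>R f x" for r x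
    by (simp add: assms(2) bilinear_lmul[OF assms(1)] bilinear_rmul[OF assms(1)] power2_eq_square)
  have zero: "representable f E 0"
    unfolding representable_def
    by (intro exI[of _ 0] exI[of _ "\<lambda>_. 0"]) (simp add: subspace_0[OF assms(3)])
  define K where "K = {\<gamma>. representable f E \<gamma> \<and> representable f E (- \<gamma>)}"
  have K: "subspace K"
  proof (rule subspaceI)
    show "0 \<in> K" using zero by (simp add: K_def)
  next
    fix x y assume "x \<in> K" "y \<in> K"
    then show "x + y \<in> K"
      using representable_add[OF assms(3), of f x y] representable_add[OF assms(3), of f "- x" "- y"]
      by (simp add: K_def)
  next
    fix c x assume x: "x \<in> K"
    show "c *\<^sub>R x \<in> K"
    proof (cases "0 \<le> c")
      case True
      then show ?thesis
        using x representable_scale[OF assms(3) _ True hom, of x]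
          representable_scale[OF assms(3) _ True hom, of "- x"]
        by (simp add: K_def)
    next
      case False
      then have c: "0 \<le> - c" by simp
      show ?thesis
        using x representable_scale[OF assms(3) _ c hom, of x]
          representable_scale[OF assms(3) _ c hom, of "- x"]
        by (simp add: K_def)
    qed
  qed
  have max: "G \<subseteq> K" if "subspace G" "\<And>\<gamma>. \<gamma> \<in> G \<Longrightarrow> representable f E \<gamma>" for G
    using that by (auto simp: K_def subspace_neg)
  have eq: "script_F f E = K"
    unfolding script_F_def
    by (rule Greatest_equality) (use K max in \<open>auto simp: K_def\<close>)
  show "subspace (script_F f E)"
    and "\<gamma> \<in> script_F f E \<Longrightarrow> representable f E \<gamma>"
    and "subspace G \<Longrightarrow> (\<And>\<gamma>. \<gamma> \<in> G \<Longrightarrow> representable f E \<gamma>) \<Longrightarrow> G \<subseteq> script_F f E"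
    using K max by (auto simp: eq K_def)
qed

end

theory Submission
  imports Defs
begin

text \<open>
  The control can follow directions outside the range of \<open>B\<close> because the quadratic term rectifies
  fast oscillations.  Let \<open>y\<close> solve the system with right-hand side \<open>\<eta> - f(\<xi>)\<close>, where the curve
  \<open>\<xi>\<close> takes its values in a subspace \<open>E\<close>, and let \<open>\<phi>(t) = sqrt 2 * sin (N * t) * \<xi>(t)\<close>.  For large
  \<open>N\<close> the curve \<open>\<phi>\<close> is small in the relaxation norm, but \<open>f(\<phi>) = f(\<xi>) - cos (2 * N * t) * f(\<xi>)\<close> has
  the mean value \<open>f(\<xi>)\<close>.  Substituting \<open>x = z + \<phi>\<close> into the system with right-hand side
  \<open>\<eta> + \<phi>'\<close> gives for \<open>z\<close> the equation of \<open>y\<close> up to terms whose primitives are of order \<open>1/N\<close>, so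
  \<open>z\<close> exists as long as \<open>y\<close> does and stays uniformly close to it.  Thus the right-hand side
  \<open>\<eta> + \<phi>'\<close>, which differs from \<open>\<eta>\<close> by an \<open>E\<close>-valued curve, does nearly the same as
  \<open>\<eta> - f(\<xi>)\<close> (\<open>relaxation_step\<close>).

  Repeating this step finitely often replaces \<open>\<xi>\<^sub>0 - f(\<xi>\<^sub>1) - \<dots> - f(\<xi>\<^sub>p)\<close> by an \<open>E\<close>-valued curve
  (\<open>relaxed_approximable\<close>).  Every curve in \<open>\<F>(E)\<close> whose coefficients are generated by polynomials, sines
  and cosines is of that form, with
  coefficients that are smooth in time: for \<open>e \<in> \<F>(E)\<close> both \<open>e\<close> and \<open>-e\<close> are representable, and a
  scalar coefficient is a difference of two squares, which the homogeneity of \<open>f\<close> absorbs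
  (\<open>curves_script_F_relaxed\<close>).  Descending from \<open>E\<^sub>n = X\<close> to \<open>E\<^sub>0 = Range(B)\<close>, it remains to
  treat right-hand sides with values in \<open>X\<close>.  There tracking is exact: \<open>\<psi>\<close> is uniformly close to a
  polynomial \<open>y\<close> with \<open>y(0) = \<psi>(0)\<close>, and \<open>y\<close> solves the system with right-hand side
  \<open>y' + A y + f(y)\<close>.

  The solution \<open>z\<close> comes from a fixed point argument for Volterra equations
  (\<open>volterra_solution\<close>), after \<open>f\<close> has been truncated to a globally Lipschitz map; the fixed point
  is so small that the truncation is not active.
\<close>

section \<open>Smooth curves in a subspace\<close>

text \<open>
  All controls are built from polynomials by multiplication with sines and by differentiation.  The
  algebra that these functions generate is closed under derivatives, which makes smoothness
  immediate (\<open>curves_C_infinity\<close>).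
\<close>

inductive_set quasi_poly :: "(real \<Rightarrow> real) set"
  where
    const: "(\<lambda>t. c) \<in> quasi_poly"
  | ident: "(\<lambda>t. t) \<in> quasi_poly"
  | sin: "(\<lambda>t. sin (w * t)) \<in> quasi_poly"
  | cos: "(\<lambda>t. cos (w * t)) \<in> quasi_poly"
  | add: "g \<in> quasi_poly \<Longrightarrow> h \<in> quasi_poly \<Longrightarrow> (\<lambda>t. g t + h t) \<in> quasi_poly"
  | mult: "g \<in> quasi_poly \<Longrightarrow> h \<in> quasi_poly \<Longrightarrow> (\<lambda>t. g t * h t) \<in> quasi_poly"

text \<open>
  Linear combinations of vectors of \<open>E\<close> with coefficients from that algebra.  With this description
  a derivative visibly stays in \<open>E\<close>, and a linear or bilinear map is applied vector by vector.
\<close>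

inductive_set curves :: "'a::real_normed_vector set \<Rightarrow> (real \<Rightarrow> 'a) set" for E
  where
    scale: "c \<in> quasi_poly \<Longrightarrow> e \<in> E \<Longrightarrow> (\<lambda>t. c t *\<^sub>R e) \<in> curves E"
  | plus: "g \<in> curves E \<Longrightarrow> h \<in> curves E \<Longrightarrow> (\<lambda>t. g t + h t) \<in> curves E"

lemma quasi_poly_deriv:
  assumes "c \<in> quasi_poly"
  shows "\<exists>c'\<in>quasi_poly. \<forall>t. (c has_real_derivative c' t) (at t)"
  using assms
proof induction
  case (const c)
  then show ?case
    by (intro bexI[of _ "\<lambda>_. 0"] allI quasi_poly.const) simp
next
  case ident
  then show ?case
    by (intro bexI[of _ "\<lambda>_. 1"] allI quasi_poly.const) simp
next
  case (sin w)
  then show ?case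
    by (intro bexI[of _ "\<lambda>t. w * cos (w * t)"] allI quasi_poly.intros)
       (auto intro!: derivative_eq_intros)
next
  case (cos w)
  then show ?case
    by (intro bexI[of _ "\<lambda>t. (- w) * sin (w * t)"] allI quasi_poly.intros)
       (auto intro!: derivative_eq_intros)
next
  case (add g h)
  then obtain g' h' where "g' \<in> quasi_poly" "h' \<in> quasi_poly"
    "\<And>t. (g has_real_derivative g' t) (at t)" "\<And>t. (h has_real_derivative h' t) (at t)"
    by blast
  then show ?case
    by (intro bexI[of _ "\<lambda>t. g' t + h' t"] allI quasi_poly.intros DERIV_add)
next
  case (mult g h)
  then obtain g' h' where "g' \<in> quasi_poly" "h' \<in> quasi_poly"
    "\<And>t. (g has_real_derivative g' t) (at t)" "\<And>t. (h has_real_derivative h' t) (at t)"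
    by blast
  with mult show ?case
    by (intro bexI[of _ "\<lambda>t. g' t * h t + h' t * g t"] allI quasi_poly.add quasi_poly.mult DERIV_mult)
qed

lemma curves_deriv:
  assumes "\<eta> \<in> curves E"
  shows "\<exists>\<eta>'\<in>curves E. \<forall>t. (\<eta> has_vector_derivative \<eta>' t) (at t)"
  using assms
proof induction
  case (scale c e)
  then obtain c' where "c' \<in> quasi_poly" "\<And>t. (c has_real_derivative c' t) (at t)"
    using quasi_poly_deriv by blast
  with scale show ?case
    by (intro bexI[of _ "\<lambda>t. c' t *\<^sub>R e"] allI curves.intros)
       (auto intro!: derivative_eq_intros)
next
  case (plus g h)
  then obtain g' h' where "g' \<in> curves E" "h' \<in> curves E"
    "\<And>t. (g has_vector_derivative g' t) (at t)" "\<And>t. (h has_vector_derivative h' t) (at t)"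
    by blast
  then show ?case
    by (intro bexI[of _ "\<lambda>t. g' t + h' t"] allI curves.intros has_vector_derivative_add)
qed

lemma curves_continuous_on:
  assumes "\<eta> \<in> curves E"
  shows "continuous_on S \<eta>"
proof -
  obtain \<eta>' where "\<And>t. (\<eta> has_vector_derivative \<eta>' t) (at t)"
    using curves_deriv[OF assms] by blast
  then show ?thesis
    by (meson continuous_at_imp_continuous_on has_vector_derivative_continuous)
qed

lemma curves_C_infinity:
  assumes "\<eta> \<in> curves E"
  shows "C_infinity_on S \<eta>"
proof -
  have "\<exists>D. D 0 = \<eta> \<and> (\<forall>k. D k \<in> curves E \<and>
      (\<forall>t. (D k has_vector_derivative D (Suc k) t) (at t)))"
  proof -
    have "\<exists>D. \<forall>k. (D k \<in> curves E \<and> (k = 0 \<longrightarrow> D k = \<eta>)) \<and>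
      (\<forall>t. (D k has_vector_derivative D (Suc k) t) (at t))"
    proof (rule dependent_nat_choice)
      show "\<exists>\<zeta>. \<zeta> \<in> curves E \<and> ((0::nat) = 0 \<longrightarrow> \<zeta> = \<eta>)"
        using assms by blast
      show "\<exists>\<zeta>'. (\<zeta>' \<in> curves E \<and> (Suc k = 0 \<longrightarrow> \<zeta>' = \<eta>)) \<and>
          (\<forall>t. (\<zeta> has_vector_derivative \<zeta>' t) (at t))"
        if "\<zeta> \<in> curves E \<and> (k = 0 \<longrightarrow> \<zeta> = \<eta>)" for \<zeta> k
        using that curves_deriv[of \<zeta> E] by auto
    qed
    then show ?thesis by blast
  qed
  then obtain D where "D 0 = \<eta>" "\<And>k t. (D k has_vector_derivative D (Suc k) t) (at t)"
    by blast
  then show ?thesis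
    unfolding C_infinity_on_def
    by (intro exI[of _ D]) (auto intro: has_vector_derivative_at_within)
qed

lemma curves_image_linear:
  assumes "linear L" "\<eta> \<in> curves E"
  shows "(\<lambda>t. L (\<eta> t)) \<in> curves (L ` E)"
  using assms(2)
proof induction
  case (scale c e)
  then show ?case
    using curves.scale[of c "L e"] by (simp add: linear_cmul[OF assms(1)])
next
  case (plus g h)
  then show ?case
    using curves.plus by (simp add: linear_add[OF assms(1)])
qed

lemma curves_mono: "E \<subseteq> F \<Longrightarrow> \<eta> \<in> curves E \<Longrightarrow> \<eta> \<in> curves F"
  by (rotate_tac 1, induction rule: curves.induct) (auto intro: curves.intros)

text \<open>
  A smooth right-hand side with values in the range of \<open>B\<close> comes from a smooth control: it suffices to
  choose preimages of the finitely many vectors that occur in it.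
\<close>

lemma curves_range_lift:
  assumes "linear B" "\<eta> \<in> curves (range B)"
  shows "\<exists>u\<in>curves UNIV. \<eta> = (\<lambda>t. B (u t))"
  using assms(2)
proof induction
  case (scale c e)
  then obtain v where "e = B v" by auto
  then show ?case
    using scale by (intro bexI[of _ "\<lambda>t. c t *\<^sub>R v"] curves.scale)
      (auto simp: linear_cmul[OF assms(1)])
next
  case (plus g h)
  then obtain u v where "u \<in> curves UNIV" "v \<in> curves UNIV"
    "g = (\<lambda>t. B (u t))" "h = (\<lambda>t. B (v t))"
    by blast
  then show ?case
    by (intro bexI[of _ "\<lambda>t. u t + v t"] curves.plus) (auto simp: linear_add[OF assms(1)])
qed

lemma curves_mult:
  assumes "c \<in> quasi_poly" "\<eta> \<in> curves E"
  shows "(\<lambda>t. c t *\<^sub>R \<eta> t) \<in> curves E"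
  using assms(2)
proof induction
  case (scale d e)
  then show ?case
    using curves.scale[OF quasi_poly.mult[OF assms(1)], of d e E] by simp
next
  case (plus g h)
  then show ?case
    using curves.plus by (simp add: scaleR_add_right)
qed

lemma curves_bilinear:
  assumes "bilinear \<Gamma>" "\<eta> \<in> curves UNIV" "\<zeta> \<in> curves UNIV"
  shows "(\<lambda>t. \<Gamma> (\<eta> t) (\<zeta> t)) \<in> curves UNIV"
  using assms(2)
proof induction
  case (scale c e)
  have "linear (\<Gamma> e)"
    using assms(1) by (simp add: bilinear_def)
  then have "(\<lambda>t. \<Gamma> e (\<zeta> t)) \<in> curves UNIV"
    using curves_image_linear[OF _ assms(3)] curves_mono by blast
  then show ?case
    using curves_mult[OF scale(1)] by (simp add: bilinear_lmul[OF assms(1)])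
next
  case (plus g h)
  then show ?case
    using curves.plus by (simp add: bilinear_ladd[OF assms(1)])
qed

lemma curves_sum:
  assumes "\<And>i. i \<in> I \<Longrightarrow> \<eta> i \<in> curves E" "finite I" "I \<noteq> {}"
  shows "(\<lambda>t. \<Sum>i\<in>I. \<eta> i t) \<in> curves E"
  using assms(2,3,1)
  by (induction rule: finite_ne_induct) (auto intro: curves.intros)

lemma polynomial_function_curve:
  fixes g :: "real \<Rightarrow> 'a::euclidean_space"
  assumes "polynomial_function g"
  shows "g \<in> curves UNIV"
proof -
  have *: "h \<in> quasi_poly" if "real_polynomial_function h" for h :: "real \<Rightarrow> real"
    using that
  proof induction
    case (linear h)
    then obtain c where "h = (\<lambda>t. t * c)"
      by (metis linear_simps(5) mult.right_neutral real_scaleR_def)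
    then show ?case
      using quasi_poly.intros by simp
  qed (auto intro: quasi_poly.intros)
  have "(\<lambda>t. g t \<bullet> b) \<in> quasi_poly" for b
    using assms * bounded_linear_inner_left[of b]
    unfolding polynomial_function_def by (auto simp: o_def)
  then have "(\<lambda>t. \<Sum>b\<in>Basis. (g t \<bullet> b) *\<^sub>R b) \<in> curves UNIV"
    by (intro curves_sum curves.scale) auto
  then show ?thesis
    by (simp add: euclidean_representation)
qed

section \<open>Volterra equations\<close>

text \<open>
  In the weighted norm \<open>sup |exp (-2 * L * t) * w(t)|\<close> the integral operator is a contraction with constant
  \<open>1/2\<close>, whatever the length of the interval.  The fixed point is therefore at most twice the
  inhomogeneity, which gives the a priori bound without a separate Gronwall argument.
\<close>

lemma volterra_solution:
  fixes g :: "real \<Rightarrow> 'a::euclidean_space \<Rightarrow> 'a"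
  assumes T: "0 \<le> T" and L: "0 < L"
    and cont: "\<And>w. continuous_on {0..T} w \<Longrightarrow> continuous_on {0..T} (\<lambda>s. g s (w s))"
    and lip: "\<And>s x y. s \<in> {0..T} \<Longrightarrow> norm (g s x - g s y) \<le> L * norm (x - y)"
    and zero: "\<And>s. s \<in> {0..T} \<Longrightarrow> g s 0 = 0"
    and R: "continuous_on {0..T} R" "\<And>t. t \<in> {0..T} \<Longrightarrow> norm (R t) \<le> \<delta>"
  shows "\<exists>w. continuous_on {0..T} w \<and>
    (\<forall>t\<in>{0..T}. w t = R t + integral {0..t} (\<lambda>s. g s (w s)) \<and> norm (w t) \<le> 2 * exp (2 * L * T) * \<delta>)"
proof -
  \<comment> \<open>The space of bounded continuous functions lives on the whole line; \<open>c\<close> extends a function on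
      the interval by its end values.\<close>
  define c where "c = (\<lambda>t. max 0 (min t T))"
  have c: "c t \<in> {0..T}" "t \<in> {0..T} \<Longrightarrow> c t = t" for t
    using T by (auto simp: c_def)
  have c_cont: "continuous_on UNIV c"
    unfolding c_def by (intro continuous_intros)
  \<comment> \<open>The unknown \<open>v\<close> of the fixed point problem is the solution with the weight built in, so that
      the plain supremum norm of \<open>v\<close> is the weighted norm of \<open>w v\<close>.\<close>
  define w where "w = (\<lambda>(v :: (real, 'a) bcontfun) s. exp (2 * L * s) *\<^sub>R apply_bcontfun v s)"
  have g_cont: "continuous_on {0..T} (\<lambda>s. g s (w v s))" for v
    by (intro cont) (auto simp: w_def intro!: continuous_intros)
  define J where "J = (\<lambda>v t. integral {0..t} (\<lambda>s. g s (w v s)))"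
  have J_cont: "continuous_on {0..T} (J v)" for v
    unfolding J_def by (intro indefinite_integral_continuous_1 integrable_continuous_real g_cont)
  define F where "F = (\<lambda>v t. exp (-2 * L * c t) *\<^sub>R (R (c t) + J v (c t)))"
  have "F v \<in> bcontfun" for v
  proof -
    have cont_h: "continuous_on {0..T} (\<lambda>t. exp (-2 * L * t) *\<^sub>R (R t + J v t))"
      by (intro continuous_intros R J_cont)
    then obtain b where b: "\<forall>t\<in>{0..T}. norm (exp (-2 * L * t) *\<^sub>R (R t + J v t)) \<le> b"
      using compact_imp_bounded[OF compact_continuous_image[OF cont_h compact_Icc]]
      unfolding bounded_iff ball_simps by blast
    show ?thesis
    proof (rule bcontfun_normI)
      show "continuous_on UNIV (F v)"
        unfolding F_def
        using continuous_on_compose2[OF cont_h c_cont image_subsetI[OF c(1)]] .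
      show "norm (F v t) \<le> b" for t
        unfolding F_def using bspec[OF b c(1)] by simp
    qed
  qed
  then have F: "apply_bcontfun (Bcontfun (F v)) = F v" for v
    by (simp add: Bcontfun_inverse)
  have J_diff: "norm (J v t - J v' t) \<le> exp (2 * L * t) / 2 * dist v v'" if t: "t \<in> {0..T}" for v v' t
  proof -
    have sub: "{0..t} \<subseteq> {0..T}" using t by auto
    have I: "((\<lambda>s. L * exp (2 * L * s) * dist v v') has_integral
        exp (2 * L * t) / 2 * dist v v' - exp (2*L*0) / 2 * dist v v') {0..t}"
      using t L
      by (intro fundamental_theorem_of_calculus)
        (auto intro!: derivative_eq_intros simp flip: has_real_derivative_iff_has_vector_derivative)
    have "norm (J v t - J v' t) = norm (integral {0..t} (\<lambda>s. g s (w v s) - g s (w v' s)))"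
      unfolding J_def
      by (subst Henstock_Kurzweil_Integration.integral_diff)
        (auto intro!: integrable_continuous_real continuous_on_subset[OF g_cont sub])
    also have "\<dots> \<le> integral {0..t} (\<lambda>s. L * exp (2 * L * s) * dist v v')"
    proof (rule Henstock_Kurzweil_Integration.integral_norm_bound_integral)
      show "(\<lambda>s. g s (w v s) - g s (w v' s)) integrable_on {0..t}"
        by (intro integrable_continuous_real continuous_on_diff continuous_on_subset[OF g_cont sub])
      show "(\<lambda>s. L * exp (2 * L * s) * dist v v') integrable_on {0..t}"
        using I by blast
      fix s assume "s \<in> {0..t}"
      then have "norm (g s (w v s) - g s (w v' s)) \<le> L * norm (w v s - w v' s)"
        using lip sub by blast
      also have "norm (w v s - w v' s) = exp (2 * L * s) * dist (apply_bcontfun v s) (apply_bcontfun v' s)"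
        unfolding w_def by (simp add: dist_norm flip: scaleR_diff_right)
      also have "L * \<dots> \<le> L * (exp (2 * L * s) * dist v v')"
        using L dist_bounded by (intro mult_left_mono) auto
      finally show "norm (g s (w v s) - g s (w v' s)) \<le> L * exp (2 * L * s) * dist v v'"
        by simp
    qed
    also have "\<dots> = exp (2 * L * t) / 2 * dist v v' - exp (2*L*0) / 2 * dist v v'"
      using I by (rule integral_unique)
    also have "\<dots> \<le> exp (2 * L * t) / 2 * dist v v'"
      by simp
    finally show ?thesis .
  qed
  have "dist (Bcontfun (F v)) (Bcontfun (F v')) \<le> 1/2 * dist v v'" for v v'
  proof (rule dist_bound)
    fix t
    have "dist (F v t) (F v' t) = exp (-2 * L * c t) * norm (J v (c t) - J v' (c t))"
      unfolding F_def by (simp add: dist_norm flip: scaleR_diff_right)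
    also have "\<dots> \<le> exp (-2 * L * c t) * (exp (2 * L * c t) / 2 * dist v v')"
      by (intro mult_left_mono J_diff c) auto
    also have "\<dots> = 1/2 * dist v v'"
      by (simp add: exp_minus)
    finally show "dist (apply_bcontfun (Bcontfun (F v)) t) (apply_bcontfun (Bcontfun (F v')) t)
        \<le> 1/2 * dist v v'"
      by (simp add: F)
  qed
  then obtain v where "Bcontfun (F v) = v"
    using banach_fix_type[of "1/2" "\<lambda>v. Bcontfun (F v)"] by auto
  then have v: "apply_bcontfun v = F v"
    using F[of v] by simp
  have w_eq: "w v t = R t + J v t" if "t \<in> {0..T}" for t
    unfolding w_def v F_def using c(2)[OF that] by (simp add: exp_minus)
  have J0: "J 0 t = 0" if "t \<in> {0..T}" for t
  proof -
    have "J 0 t = integral {0..t} (\<lambda>s. 0)"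
      unfolding J_def using that zero by (intro integral_cong) (auto simp: w_def)
    then show ?thesis by simp
  qed
  have "norm v \<le> \<delta> + norm v / 2"
  proof (rule norm_bound)
    fix t
    have "norm (apply_bcontfun v t) \<le> exp (-2 * L * c t) * (norm (R (c t)) + norm (J v (c t) - J 0 (c t)))"
      unfolding v F_def by (auto simp: J0[OF c(1)] intro!: norm_triangle_ineq)
    also have "\<dots> \<le> exp (-2 * L * c t) * (\<delta> + exp (2 * L * c t) / 2 * dist v 0)"
      by (intro mult_left_mono add_mono J_diff c R) auto
    also have "\<dots> = exp (-2 * L * c t) * \<delta> + norm v / 2"
      by (simp add: exp_minus distrib_left)
    also have "exp (-2 * L * c t) * \<delta> \<le> 1 * \<delta>"
      using L c(1)[of t] order_trans[OF norm_ge_zero R(2)[OF c(1)[of t]]]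
      by (intro mult_right_mono) auto
    finally show "norm (apply_bcontfun v t) \<le> \<delta> + norm v / 2"
      by simp
  qed
  then have nv: "norm v \<le> 2 * \<delta>" by simp
  have "norm (w v t) \<le> 2 * exp (2 * L * T) * \<delta>" if "t \<in> {0..T}" for t
  proof -
    have "norm (w v t) \<le> exp (2 * L * t) * norm v"
      unfolding w_def using norm_bounded[of v t] by simp
    also have "\<dots> \<le> exp (2 * L * T) * (2 * \<delta>)"
      using that L nv by (intro mult_mono) auto
    finally show ?thesis by simp
  qed
  moreover have "continuous_on {0..T} (w v)"
    unfolding w_def by (auto intro!: continuous_intros)
  ultimately show ?thesis
    using w_eq unfolding J_def by blast
qed

section \<open>Integrals of fast oscillations\<close>

text \<open>
  Integration by parts: a weight whose primitive is small has small integrals against a function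
  of class \<open>C\<^sup>1\<close>.
\<close>

lemma oscillating_integral:
  fixes h :: "real \<Rightarrow> 'a::euclidean_space"
  assumes T: "0 \<le> T"
    and h: "\<And>t. t \<in> {0..T} \<Longrightarrow> (h has_vector_derivative h' t) (at t within {0..T})"
    and h': "continuous_on {0..T} h'"
    and M: "\<And>t. t \<in> {0..T} \<Longrightarrow> norm (h t) \<le> M" "\<And>t. t \<in> {0..T} \<Longrightarrow> norm (h' t) \<le> M"
    and P: "\<And>t. (P has_real_derivative p t) (at t)" "\<And>t. \<bar>P t\<bar> \<le> \<delta>"
    and t: "t \<in> {0..T}"
  shows "norm (integral {0..t} (\<lambda>s. p s *\<^sub>R h s)) \<le> \<delta> * M * (2 + T)"
proof -
  have sub: "{0..t} \<subseteq> {0..T}" using t by auto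
  have P_cont: "continuous_on {0..t} P"
    using P(1) by (meson DERIV_isCont continuous_at_imp_continuous_on)
  have "((\<lambda>s. P s *\<^sub>R h' s + p s *\<^sub>R h s) has_integral P t *\<^sub>R h t - P 0 *\<^sub>R h 0) {0..t}"
    using t by (intro fundamental_theorem_of_calculus has_vector_derivative_scaleR
      has_vector_derivative_within_subset[OF h sub] DERIV_subset[OF P(1)]) auto
  moreover have int: "(\<lambda>s. P s *\<^sub>R h' s) integrable_on {0..t}"
    by (intro integrable_continuous_real continuous_intros P_cont continuous_on_subset[OF h' sub])
  ultimately have "((\<lambda>s. (P s *\<^sub>R h' s + p s *\<^sub>R h s) - P s *\<^sub>R h' s) has_integral
      (P t *\<^sub>R h t - P 0 *\<^sub>R h 0) - integral {0..t} (\<lambda>s. P s *\<^sub>R h' s)) {0..t}"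
    by (intro has_integral_diff integrable_integral)
  then have parts: "integral {0..t} (\<lambda>s. p s *\<^sub>R h s) =
      P t *\<^sub>R h t - P 0 *\<^sub>R h 0 - integral {0..t} (\<lambda>s. P s *\<^sub>R h' s)"
    by (simp add: integral_unique)
  have d: "0 \<le> \<delta>" using P(2)[of 0] by linarith
  have "norm (integral {0..t} (\<lambda>s. P s *\<^sub>R h' s)) \<le> \<delta> * M * (t - 0)"
  proof (rule integral_bound)
    show "continuous_on {0..t} (\<lambda>s. P s *\<^sub>R h' s)"
      by (intro continuous_intros P_cont continuous_on_subset[OF h' sub])
    show "norm (P s *\<^sub>R h' s) \<le> \<delta> * M" if "s \<in> {0..t}" for s
      using that sub d P(2)[of s] M(2)[of s] by (auto intro!: mult_mono)
  qed (use t in auto)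
  moreover have "norm (P s *\<^sub>R h s) \<le> \<delta> * M" if "s \<in> {0..T}" for s
    using that d P(2)[of s] M(1)[of s] by (auto intro!: mult_mono)
  then have "norm (P t *\<^sub>R h t) \<le> \<delta> * M" "norm (P 0 *\<^sub>R h 0) \<le> \<delta> * M"
    using t T by auto
  moreover have "\<delta> * M * (t - 0) \<le> \<delta> * M * T"
    using t d order_trans[OF norm_ge_zero M(1)[OF t]] by (intro mult_left_mono) auto
  ultimately have "norm (integral {0..t} (\<lambda>s. p s *\<^sub>R h s)) \<le> \<delta> * M + \<delta> * M + \<delta> * M * T"
    unfolding parts
    using norm_triangle_ineq4[of "P t *\<^sub>R h t - P 0 *\<^sub>R h 0" "integral {0..t} (\<lambda>s. P s *\<^sub>R h' s)"]
      norm_triangle_ineq4[of "P t *\<^sub>R h t" "P 0 *\<^sub>R h 0"]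
    by linarith
  then show ?thesis
    by (simp add: algebra_simps)
qed

lemma continuous_on_Icc_norm_bound:
  fixes h :: "real \<Rightarrow> 'a::real_normed_vector"
  assumes "continuous_on {a..b} h"
  obtains M where "0 < M" "\<And>t. t \<in> {a..b} \<Longrightarrow> norm (h t) \<le> M"
proof -
  obtain M where "0 < M" "\<forall>t\<in>{a..b}. norm (h t) \<le> M"
    using compact_imp_bounded[OF compact_continuous_image[OF assms compact_Icc]]
    unfolding bounded_pos ball_simps by blast
  then show ?thesis
    using that by blast
qed

section \<open>Quadratic systems\<close>

locale quadratic_system =
  fixes A :: "'x::euclidean_space \<Rightarrow> 'x"
    and \<Gamma> :: "'x \<Rightarrow> 'x \<Rightarrow> 'x"
    and f :: "'x \<Rightarrow> 'x"
  assumes linear_A: "linear A"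
    and bilinear_\<Gamma>: "bilinear \<Gamma>"
    and sym: "\<Gamma> x y = \<Gamma> y x"
    and f_eq: "f x = \<Gamma> x x"
begin

lemmas \<Gamma>_simps =
  bilinear_ladd[OF bilinear_\<Gamma>] bilinear_radd[OF bilinear_\<Gamma>]
  bilinear_lsub[OF bilinear_\<Gamma>] bilinear_rsub[OF bilinear_\<Gamma>]
  bilinear_lmul[OF bilinear_\<Gamma>] bilinear_rmul[OF bilinear_\<Gamma>]
  bilinear_lzero[OF bilinear_\<Gamma>] bilinear_rzero[OF bilinear_\<Gamma>]
  bilinear_lneg[OF bilinear_\<Gamma>] bilinear_rneg[OF bilinear_\<Gamma>]

lemmas A_simps =
  linear_add[OF linear_A] linear_diff[OF linear_A] linear_cmul[OF linear_A] linear_0[OF linear_A]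

lemma f_scale: "f (r *\<^sub>R x) = r\<^sup>2 *\<^sub>R f x"
  by (simp add: f_eq \<Gamma>_simps power2_eq_square)

lemma f_diff: "f x - f y = \<Gamma> (x + y) (x - y)"
  by (simp add: f_eq \<Gamma>_simps sym[of y x])

lemma continuous_on_A: "continuous_on S g \<Longrightarrow> continuous_on S (\<lambda>t. A (g t))"
  for g :: "real \<Rightarrow> 'x"
  by (rule linear_continuous_on_compose[OF _ linear_A])

lemma continuous_on_\<Gamma>:
  "continuous_on S g \<Longrightarrow> continuous_on S h \<Longrightarrow> continuous_on S (\<lambda>t. \<Gamma> (g t) (h t))"
  for g :: "real \<Rightarrow> 'x"
  by (rule bilinear_continuous_on_compose[OF _ _ bilinear_\<Gamma>])

lemma continuous_on_f: "continuous_on S g \<Longrightarrow> continuous_on S (\<lambda>t. f (g t))"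
  for g :: "real \<Rightarrow> 'x"
  unfolding f_eq by (rule continuous_on_\<Gamma>)

lemma has_vector_derivative_A:
  "(g has_vector_derivative g') F \<Longrightarrow> ((\<lambda>t. A (g t)) has_vector_derivative A g') F"
  using bounded_linear.has_vector_derivative linear_A linear_conv_bounded_linear by blast

lemma has_vector_derivative_\<Gamma>:
  "(g has_vector_derivative g') (at t within S) \<Longrightarrow> (h has_vector_derivative h') (at t within S) \<Longrightarrow>
   ((\<lambda>t. \<Gamma> (g t) (h t)) has_vector_derivative \<Gamma> (g t) h' + \<Gamma> g' (h t)) (at t within S)"
  using bounded_bilinear.has_vector_derivative bilinear_\<Gamma> bilinear_conv_bounded_bilinear by blast

definition solves :: "real \<Rightarrow> (real \<Rightarrow> 'x) \<Rightarrow> (real \<Rightarrow> 'x) \<Rightarrow> bool"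
  where "solves T \<eta> y \<longleftrightarrow>
    (\<forall>t\<in>{0..T}. (y has_vector_derivative \<eta> t - A (y t) - f (y t)) (at t within {0..T}))"

lemma solves_continuous: "solves T \<eta> y \<Longrightarrow> continuous_on {0..T} y"
  unfolding solves_def
  by (meson continuous_on_eq_continuous_within has_vector_derivative_continuous)

text \<open>
  The difference \<open>d\<close> of two solutions satisfies a linear differential inequality, because \<open>f\<close> is
  Lipschitz on the bounded region that contains both, so \<open>exp (-2 * L * t) * |d(t)|\<^sup>2\<close> decreases.
\<close>

lemma solves_unique:
  assumes y: "solves T \<eta> y" and z: "solves T \<eta> z" and init: "y 0 = z 0" and t: "t \<in> {0..T}"
  shows "y t = z t"
proof -
  note cont = solves_continuous[OF y] solves_continuous[OF z]
  obtain M where M: "0 < M" "\<And>s. s \<in> {0..T} \<Longrightarrow> norm (y s + z s) \<le> M"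
    using continuous_on_Icc_norm_bound[OF continuous_on_add[OF cont]] by blast
  obtain a where a: "0 < a" "\<And>x. norm (A x) \<le> a * norm x"
    using linear_bounded_pos[OF linear_A] by (metis mult.commute)
  obtain K where K: "0 < K" "\<And>x y. norm (\<Gamma> x y) \<le> K * norm x * norm y"
    using bilinear_bounded_pos[OF bilinear_\<Gamma>] by auto
  define L where "L = a + K * M"
  define d where "d = (\<lambda>s. y s - z s)"
  define d' where "d' = (\<lambda>s. - A (d s) - \<Gamma> (y s + z s) (d s))"
  have d: "(d has_vector_derivative d' s) (at s within {0..T})" if "s \<in> {0..T}" for s
  proof -
    have "(d has_vector_derivative (\<eta> s - A (y s) - f (y s)) - (\<eta> s - A (z s) - f (z s)))
        (at s within {0..T})"
      unfolding d_def using y z that by (intro has_vector_derivative_diff) (auto simp: solves_def)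
    also have "(\<eta> s - A (y s) - f (y s)) - (\<eta> s - A (z s) - f (z s)) = d' s"
      unfolding d'_def d_def f_diff[symmetric] by (simp add: A_simps)
    finally show ?thesis .
  qed
  have d': "norm (d' s) \<le> L * norm (d s)" if "s \<in> {0..T}" for s
  proof -
    have "norm (d' s) \<le> norm (A (d s)) + norm (\<Gamma> (y s + z s) (d s))"
      unfolding d'_def by (metis norm_minus_cancel norm_triangle_ineq4)
    also have "norm (\<Gamma> (y s + z s) (d s)) \<le> K * M * norm (d s)"
      using K(1) M(2)[OF that]
      by (intro order_trans[OF K(2)] mult_right_mono mult_left_mono) auto
    finally show ?thesis
      using a(2)[of "d s"] by (simp add: L_def algebra_simps)
  qed
  define h where "h = (\<lambda>s. exp (-2 * L * s) * (d s \<bullet> d s))"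
  have "h t \<le> h 0"
  proof (rule DERIV_nonpos_imp_decreasing_open[of 0 t h])
    show "0 \<le> t" using t by simp
    show "continuous_on {0..t} h"
      unfolding h_def d_def using t
      by (intro continuous_intros continuous_on_subset[OF cont(1)] continuous_on_subset[OF cont(2)]) auto
    fix s assume s: "0 < s" "s < t"
    then have "s \<in> {0..T}" "at s within {0..T} = at s"
      using t by (auto intro!: at_within_interior)
    then have ds: "(d has_vector_derivative d' s) (at s)"
      using d[of s] by simp
    have "(h has_real_derivative exp (-2 * L * s) * (2 * (d s \<bullet> d' s) - 2 * L * (d s \<bullet> d s))) (at s)"
      unfolding h_def has_real_derivative_iff_has_vector_derivative
      using ds unfolding has_vector_derivative_def
      by (auto intro!: derivative_eq_intros simp: fun_eq_iff algebra_simps inner_commute)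
    moreover have "d s \<bullet> d' s \<le> L * (d s \<bullet> d s)"
    proof -
      have "d s \<bullet> d' s \<le> norm (d s) * norm (d' s)"
        by (rule norm_cauchy_schwarz)
      also have "\<dots> \<le> norm (d s) * (L * norm (d s))"
        by (intro mult_left_mono d') (use \<open>s \<in> {0..T}\<close> in auto)
      also have "\<dots> = L * (d s \<bullet> d s)"
        by (simp add: power2_norm_eq_inner[symmetric] power2_eq_square)
      finally show ?thesis .
    qed
    then have "exp (-2 * L * s) * (2 * (d s \<bullet> d' s) - 2 * L * (d s \<bullet> d s)) \<le> 0"
      by (intro mult_nonneg_nonpos) auto
    ultimately show "\<exists>y. (h has_real_derivative y) (at s) \<and> y \<le> 0"
      by blast
  qed
  also have "h 0 = 0"
    by (simp add: h_def d_def init)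
  finally have "d t \<bullet> d t \<le> 0"
    by (simp add: h_def mult_le_0_iff)
  then have "d t = 0"
    by (metis antisym inner_eq_zero_iff inner_ge_zero)
  then show ?thesis
    by (simp add: d_def)
qed

text \<open>
  Here \<open>z\<close> is subject to the perturbation \<open>\<phi>\<close>, and \<open>q\<close> is the mean effect of \<open>f(\<phi>)\<close>.  The hypothesis
  bounds the primitive of the residual only, not the residual itself; that is what makes the lemma
  applicable to oscillations.  The difference \<open>w = z - y\<close> satisfies
  \<open>w' = r - A w - 2 \<Gamma>(y + \<phi>, w) - f(w)\<close> with the residual \<open>r\<close>, a Volterra equation whose
  inhomogeneity is the primitive of \<open>r\<close>.  As \<open>C\<close> depends only on \<open>A\<close>, \<open>\<Gamma>\<close>, \<open>T\<close> and the bound \<open>M\<close>, the frequency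
  of an oscillation \<open>\<phi>\<close> can be chosen after \<open>C\<close>.
\<close>

lemma perturbed_solution:
  assumes T: "0 \<le> T"
  obtains C where "0 < C"
    "\<And>\<eta> q y \<phi> \<delta>. solves T (\<lambda>t. \<eta> t - q t) y \<Longrightarrow>
      continuous_on {0..T} \<phi> \<Longrightarrow> continuous_on {0..T} q \<Longrightarrow>
      (\<And>t. t \<in> {0..T} \<Longrightarrow> norm (y t + \<phi> t) \<le> M) \<Longrightarrow>
      (\<And>t. t \<in> {0..T} \<Longrightarrow>
        norm (integral {0..t} (\<lambda>s. q s - f (\<phi> s) - A (\<phi> s) - 2 *\<^sub>R \<Gamma> (y s) (\<phi> s))) \<le> \<delta>) \<Longrightarrow>
      C * \<delta> \<le> 1 \<Longrightarrow>
      \<exists>z. z 0 = y 0 \<and> (\<forall>t\<in>{0..T}. norm (z t - y t) \<le> C * \<delta> \<and>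
        (z has_vector_derivative \<eta> t - A (z t + \<phi> t) - f (z t + \<phi> t)) (at t within {0..T}))"
proof -
  obtain a where a: "0 < a" "\<And>x. norm (A x) \<le> a * norm x"
    using linear_bounded_pos[OF linear_A] by (metis mult.commute)
  obtain K where K: "0 < K" "\<And>x y. norm (\<Gamma> x y) \<le> K * norm x * norm y"
    using bilinear_bounded_pos[OF bilinear_\<Gamma>] by auto
  define L where "L = a + 2 * (K * max 0 M) + 2 * K"
  have L: "0 < L"
    unfolding L_def using a K by (intro add_pos_pos add_pos_nonneg) auto
  define C where "C = 2 * exp (2 * L * T)"
  have "\<exists>z. z 0 = y 0 \<and> (\<forall>t\<in>{0..T}. norm (z t - y t) \<le> C * \<delta> \<and>
        (z has_vector_derivative \<eta> t - A (z t + \<phi> t) - f (z t + \<phi> t)) (at t within {0..T}))"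
    if y: "solves T (\<lambda>t. \<eta> t - q t) y"
      and \<phi>: "continuous_on {0..T} \<phi>" and q: "continuous_on {0..T} q"
      and M: "\<And>t. t \<in> {0..T} \<Longrightarrow> norm (y t + \<phi> t) \<le> M"
      and int: "\<And>t. t \<in> {0..T} \<Longrightarrow>
        norm (integral {0..t} (\<lambda>s. q s - f (\<phi> s) - A (\<phi> s) - 2 *\<^sub>R \<Gamma> (y s) (\<phi> s))) \<le> \<delta>"
      and \<delta>: "C * \<delta> \<le> 1" for \<eta> q y \<phi> \<delta>
  proof -
    define r where "r = (\<lambda>s. q s - f (\<phi> s) - A (\<phi> s) - 2 *\<^sub>R \<Gamma> (y s) (\<phi> s))"
    \<comment> \<open>The projection to the unit ball makes the quadratic term globally Lipschitz; it is the
        identity on the solution, because \<open>C * \<delta> \<le> 1\<close>.\<close>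
    define clip where "clip = closest_point (cball (0::'x) 1)"
    define g where "g = (\<lambda>s x. - A x - 2 *\<^sub>R \<Gamma> (y s + \<phi> s) x - f (clip x))"
    note y_cont = solves_continuous[OF y]
    have r_cont: "continuous_on {0..T} r"
      unfolding r_def
      by (intro continuous_intros continuous_on_f continuous_on_A continuous_on_\<Gamma> \<phi> q y_cont)
    have clip_cont: "continuous_on S clip" for S
      unfolding clip_def by (intro continuous_on_closest_point) auto
    have clip_norm: "norm (clip x) \<le> 1" for x
      using closest_point_in_set[of "cball (0::'x) 1" x] by (simp add: clip_def)
    have clip_lip: "norm (clip x - clip x') \<le> norm (x - x')" for x x'
      using closest_point_lipschitz[of "cball (0::'x) 1" x x'] by (simp add: clip_def dist_norm)
    have g_cont: "continuous_on {0..T} (\<lambda>s. g s (w s))" if "continuous_on {0..T} w" for w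
      unfolding g_def
      by (intro continuous_intros continuous_on_f continuous_on_A continuous_on_\<Gamma> \<phi> y_cont that
        continuous_on_compose2[OF clip_cont[of UNIV] that]) auto
    have "\<exists>w. continuous_on {0..T} w \<and> (\<forall>t\<in>{0..T}.
        w t = integral {0..t} r + integral {0..t} (\<lambda>s. g s (w s)) \<and>
        norm (w t) \<le> 2 * exp (2 * L * T) * \<delta>)"
    proof (rule volterra_solution[OF T L g_cont])
      fix s x x' assume s: "s \<in> {0..T}"
      have "norm (g s x - g s x') = norm (A (x - x') + 2 *\<^sub>R \<Gamma> (y s + \<phi> s) (x - x')
          + \<Gamma> (clip x + clip x') (clip x - clip x'))"
        unfolding g_def f_diff[symmetric]
        by (subst norm_minus_cancel[symmetric]) (simp add: A_simps \<Gamma>_simps algebra_simps)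
      also have "\<dots> \<le> norm (A (x - x')) + 2 * norm (\<Gamma> (y s + \<phi> s) (x - x'))
          + norm (\<Gamma> (clip x + clip x') (clip x - clip x'))"
        by (intro order_trans[OF norm_triangle_ineq] add_mono) auto
      also have "norm (\<Gamma> (y s + \<phi> s) (x - x')) \<le> K * max 0 M * norm (x - x')"
        using K(1) M[OF s]
        by (intro order_trans[OF K(2)] mult_right_mono mult_left_mono) auto
      also have "norm (\<Gamma> (clip x + clip x') (clip x - clip x')) \<le> K * 2 * norm (x - x')"
        using K(1) norm_triangle_ineq[of "clip x" "clip x'"] clip_norm[of x] clip_norm[of x']
        by (intro order_trans[OF K(2)] mult_mono mult_left_mono clip_lip) auto
      finally show "norm (g s x - g s x') \<le> L * norm (x - x')"
        using a(2)[of "x - x'"] by (simp add: L_def algebra_simps)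
    next
      show "g s 0 = 0" if "s \<in> {0..T}" for s
        by (simp add: g_def A_simps \<Gamma>_simps clip_def closest_point_self f_eq)
      show "continuous_on {0..T} (\<lambda>t. integral {0..t} r)"
        by (intro indefinite_integral_continuous_1 integrable_continuous_real r_cont)
      show "norm (integral {0..t} r) \<le> \<delta>" if "t \<in> {0..T}" for t
        unfolding r_def using int[OF that] .
    qed
    then obtain w where w_cont: "continuous_on {0..T} w"
      and w: "\<And>t. t \<in> {0..T} \<Longrightarrow> w t = integral {0..t} r + integral {0..t} (\<lambda>s. g s (w s))"
      and w_norm: "\<And>t. t \<in> {0..T} \<Longrightarrow> norm (w t) \<le> C * \<delta>"
      unfolding C_def by blast
    have "((\<lambda>t. y t + w t) has_vector_derivative
        \<eta> t - A (y t + w t + \<phi> t) - f (y t + w t + \<phi> t)) (at t within {0..T})"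
      if t: "t \<in> {0..T}" for t
    proof -
      have "((\<lambda>t. integral {0..t} r + integral {0..t} (\<lambda>s. g s (w s))) has_vector_derivative
          r t + g t (w t)) (at t within {0..T})"
        by (intro has_vector_derivative_add integral_has_vector_derivative r_cont g_cont w_cont t)
      then have "(w has_vector_derivative r t + g t (w t)) (at t within {0..T})"
        by (rule has_vector_derivative_transform[OF t, rotated]) (use w in auto)
      then have "((\<lambda>t. y t + w t) has_vector_derivative
          (\<eta> t - q t - A (y t) - f (y t)) + (r t + g t (w t))) (at t within {0..T})"
        using y t unfolding solves_def by (intro has_vector_derivative_add) auto
      also have "clip (w t) = w t"
        unfolding clip_def using w_norm[OF t] \<delta> by (intro closest_point_self) auto
      then have "(\<eta> t - q t - A (y t) - f (y t)) + (r t + g t (w t)) =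
          \<eta> t - A (y t + w t + \<phi> t) - f (y t + w t + \<phi> t)"
        unfolding r_def g_def f_eq
        by (simp add: A_simps \<Gamma>_simps sym[of "\<phi> t" "y t"] sym[of "w t" "y t"]
          sym[of "w t" "\<phi> t"] scaleR_2)
      finally show ?thesis .
    qed
    then show ?thesis
      using w[of 0] w_norm T by (intro exI[of _ "\<lambda>t. y t + w t"]) auto
  qed
  then show ?thesis
    using that[of C] by (simp add: C_def)
qed

text \<open>
  Closeness in the sense of the theorem, on the level of Henstock--Kurzweil integrals, with the two
  errors bounded separately.
\<close>

definition relax_close :: "real \<Rightarrow> real \<Rightarrow> (real \<Rightarrow> 'x) \<Rightarrow> (real \<Rightarrow> 'x) \<Rightarrow> bool"
  where "relax_close T \<epsilon> x y \<longleftrightarrow>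
    norm (x T - y T) < \<epsilon> \<and> (\<forall>t\<in>{0..T}. norm (integral {0..t} (\<lambda>s. x s - y s)) < \<epsilon>)"

lemma relax_close_trans:
  assumes "continuous_on {0..T} x" "continuous_on {0..T} y" "continuous_on {0..T} z"
    and "relax_close T \<epsilon> x y" "relax_close T \<delta> y z"
  shows "relax_close T (\<epsilon> + \<delta>) x z"
proof -
  have "norm (integral {0..t} (\<lambda>s. x s - z s)) < \<epsilon> + \<delta>" if t: "t \<in> {0..T}" for t
  proof -
    have sub: "{0..t} \<subseteq> {0..T}" using t by auto
    have "integral {0..t} (\<lambda>s. (x s - y s) + (y s - z s)) =
        integral {0..t} (\<lambda>s. x s - y s) + integral {0..t} (\<lambda>s. y s - z s)"
      by (intro Henstock_Kurzweil_Integration.integral_add integrable_continuous_real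
        continuous_on_diff assms(1-3)[THEN continuous_on_subset[OF _ sub]])
    then have "norm (integral {0..t} (\<lambda>s. x s - z s)) \<le>
        norm (integral {0..t} (\<lambda>s. x s - y s)) + norm (integral {0..t} (\<lambda>s. y s - z s))"
      by (simp add: norm_triangle_ineq)
    also have "\<dots> < \<epsilon> + \<delta>"
      using assms(4,5) t by (intro add_strict_mono) (auto simp: relax_close_def)
    finally show ?thesis .
  qed
  moreover have "norm (x T - z T) < \<epsilon> + \<delta>"
    using assms(4,5) norm_triangle_ineq[of "x T - y T" "y T - z T"] by (auto simp: relax_close_def)
  ultimately show ?thesis
    by (auto simp: relax_close_def)
qed

text \<open>
  The rectification effect of \<open>\<phi>(t) = sqrt 2 * sin (N * t) * \<xi>(t)\<close>.  The factor \<open>sqrt 2\<close> normalises the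
  mean of \<open>2 * sin\<^sup>2\<close> to \<open>1\<close>, and \<open>N\<close> is a multiple of \<open>2 * pi / T\<close>, so that \<open>\<phi>\<close> vanishes at both ends
  and changes neither the initial nor the final value.
\<close>

lemma relaxation_step:
  assumes T: "0 < T" and \<epsilon>: "0 < \<epsilon>" and \<eta>: "continuous_on {0..T} \<eta>" and \<xi>: "\<xi> \<in> curves E"
    and y: "solves T (\<lambda>t. \<eta> t - f (\<xi> t)) y"
  shows "\<exists>\<phi>'\<in>curves E. \<exists>x. solves T (\<lambda>t. \<eta> t + \<phi>' t) x \<and> x 0 = y 0 \<and> relax_close T \<epsilon> x y"
proof -
  obtain \<xi>' where \<xi>': "\<xi>' \<in> curves E" "\<And>t. (\<xi> has_vector_derivative \<xi>' t) (at t)"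
    using curves_deriv[OF \<xi>] by blast
  define y' where "y' = (\<lambda>t. \<eta> t - f (\<xi> t) - A (y t) - f (y t))"
  \<comment> \<open>With \<open>q = f(\<xi>)\<close> the residual is \<open>sin (N * t) * h(t) + cos (2 * N * t) * f(\<xi>(t))\<close>; \<open>h'\<close> and \<open>k'\<close>
      are the derivatives of the two amplitudes.\<close>
  define h where "h = (\<lambda>t. - sqrt 2 *\<^sub>R (A (\<xi> t) + 2 *\<^sub>R \<Gamma> (y t) (\<xi> t)))"
  define h' where "h' = (\<lambda>t. - sqrt 2 *\<^sub>R (A (\<xi>' t) + 2 *\<^sub>R (\<Gamma> (y t) (\<xi>' t) + \<Gamma> (y' t) (\<xi> t))))"
  define k' where "k' = (\<lambda>t. \<Gamma> (\<xi> t) (\<xi>' t) + \<Gamma> (\<xi>' t) (\<xi> t))"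
  note cont = curves_continuous_on[OF \<xi>] curves_continuous_on[OF \<xi>'(1)] solves_continuous[OF y] \<eta>
  note scaleR_deriv = bounded_linear.has_vector_derivative[OF bounded_linear_scaleR_right]
  note f_cont = continuous_on_A continuous_on_f continuous_on_\<Gamma>
  have y'_cont: "continuous_on {0..T} y'"
    unfolding y'_def by (intro continuous_on_diff f_cont cont)
  have h_cont: "continuous_on {0..T} h" "continuous_on {0..T} h'" "continuous_on {0..T} k'"
    unfolding h_def h'_def k'_def
    by (intro continuous_on_scaleR continuous_on_const continuous_on_add f_cont cont y'_cont)+
  have \<xi>_deriv: "(\<xi> has_vector_derivative \<xi>' t) (at t within {0..T})" for t
    using \<xi>'(2) has_vector_derivative_at_within by blast
  have h_deriv: "(h has_vector_derivative h' t) (at t within {0..T})" if "t \<in> {0..T}" for t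
    unfolding h_def h'_def using y that
    by (intro scaleR_deriv has_vector_derivative_add has_vector_derivative_A
        has_vector_derivative_\<Gamma> \<xi>_deriv) (auto simp: solves_def y'_def)
  have k_deriv: "((\<lambda>t. f (\<xi> t)) has_vector_derivative k' t) (at t within {0..T})" for t
    unfolding f_eq k'_def by (intro has_vector_derivative_\<Gamma> \<xi>_deriv)
  have sum_cont: "continuous_on {0..T} (\<lambda>t. norm (h t) + norm (h' t) + norm (f (\<xi> t)) + norm (k' t)
      + sqrt 2 * (norm (\<xi> t) + norm (\<xi>' t)) + norm (y t))"
    by (intro continuous_intros h_cont f_cont cont)
  obtain M where M: "0 < M" and sum_M: "\<And>t. t \<in> {0..T} \<Longrightarrow>
      norm (norm (h t) + norm (h' t) + norm (f (\<xi> t)) + norm (k' t)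
      + sqrt 2 * (norm (\<xi> t) + norm (\<xi>' t)) + norm (y t)) \<le> M"
    using continuous_on_Icc_norm_bound[OF sum_cont] by blast
  have bounds: "norm (h t) \<le> M" "norm (h' t) \<le> M" "norm (f (\<xi> t)) \<le> M" "norm (k' t) \<le> M"
    "sqrt 2 * norm (\<xi> t) \<le> M" "sqrt 2 * norm (\<xi>' t) \<le> M" "norm (y t) \<le> M" if "t \<in> {0..T}" for t
  proof -
    have "0 \<le> sqrt 2 * norm (\<xi> t)" "0 \<le> sqrt 2 * norm (\<xi>' t)" by simp_all
    then show "norm (h t) \<le> M" "norm (h' t) \<le> M" "norm (f (\<xi> t)) \<le> M" "norm (k' t) \<le> M"
      "sqrt 2 * norm (\<xi> t) \<le> M" "sqrt 2 * norm (\<xi>' t) \<le> M" "norm (y t) \<le> M"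
      using sum_M[OF that] norm_ge_zero[of "h t"] norm_ge_zero[of "h' t"] norm_ge_zero[of "f (\<xi> t)"]
        norm_ge_zero[of "k' t"] norm_ge_zero[of "y t"]
      unfolding real_norm_def distrib_left by linarith+
  qed
  obtain C where C: "0 < C" and perturbed:
    "\<And>\<eta> q y \<phi> \<delta>. solves T (\<lambda>t. \<eta> t - q t) y \<Longrightarrow>
      continuous_on {0..T} \<phi> \<Longrightarrow> continuous_on {0..T} q \<Longrightarrow>
      (\<And>t. t \<in> {0..T} \<Longrightarrow> norm (y t + \<phi> t) \<le> 2 * M) \<Longrightarrow>
      (\<And>t. t \<in> {0..T} \<Longrightarrow>
        norm (integral {0..t} (\<lambda>s. q s - f (\<phi> s) - A (\<phi> s) - 2 *\<^sub>R \<Gamma> (y s) (\<phi> s))) \<le> \<delta>) \<Longrightarrow>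
      C * \<delta> \<le> 1 \<Longrightarrow>
      \<exists>z. z 0 = y 0 \<and> (\<forall>t\<in>{0..T}. norm (z t - y t) \<le> C * \<delta> \<and>
        (z has_vector_derivative \<eta> t - A (z t + \<phi> t) - f (z t + \<phi> t)) (at t within {0..T}))"
    using perturbed_solution[OF less_imp_le[OF T], of "2 * M"] by blast
  define D where "D = M * (2 + T)"
  have D: "0 < D" unfolding D_def using M T by simp
  \<comment> \<open>\<open>D / N\<close> will bound each oscillating integral and \<open>C * (2 * D / N)\<close> the distance of \<open>z\<close> and \<open>y\<close>;
      \<open>Q / n\<close> collects all errors, and \<open>Q / n < 1\<close> gives the smallness that the existence of \<open>z\<close>
      requires.\<close>
  define Q where "Q = (C * 2 * (1 + T) + 1) * D * T / (2 * pi)"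
  define m where "m = min \<epsilon> 1"
  have m: "0 < m" "m \<le> \<epsilon>" "m \<le> 1"
    using \<epsilon> by (auto simp: m_def)
  obtain n :: nat where n: "0 < n" "Q / m < real n"
    using reals_Archimedean2[of "max 0 (Q / m)"] by auto
  define N where "N = real n * (2 * pi / T)"
  have N: "0 < N" unfolding N_def using n T by simp
  have small: "(C * 2 * (1 + T) + 1) * D / N < m"
  proof -
    have "Q < real n * m"
      using n(2) m by (simp add: pos_divide_less_eq)
    then have "Q / real n < m"
      using n(1) by (simp add: pos_divide_less_eq mult.commute)
    also have "Q / real n = (C * 2 * (1 + T) + 1) * D / N"
      unfolding Q_def N_def using n(1) T by simp
    finally show ?thesis .
  qed
  have pieces: "C * (2 * D / N) \<ge> 0" "C * (2 * D / N) * T \<ge> 0" "D / N \<ge> 0"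
    "C * (2 * D / N) + C * (2 * D / N) * T + D / N = (C * 2 * (1 + T) + 1) * D / N"
    using C D N T by (auto simp: field_simps)
  define \<phi> where "\<phi> = (\<lambda>t. (sqrt 2 * sin (N * t)) *\<^sub>R \<xi> t)"
  have \<phi>_curve: "\<phi> \<in> curves E"
    unfolding \<phi>_def by (intro curves_mult quasi_poly.intros \<xi>)
  obtain \<phi>' where \<phi>': "\<phi>' \<in> curves E" "\<And>t. (\<phi> has_vector_derivative \<phi>' t) (at t)"
    using curves_deriv[OF \<phi>_curve] by blast
  have ends: "\<phi> 0 = 0" "\<phi> T = 0"
  proof -
    have "N * T = real n * (2 * pi)"
      unfolding N_def using T by simp
    then have "sin (N * T) = 0"
      using sin_npi[of "2 * n"] by (simp add: mult_ac)
    then show "\<phi> 0 = 0" "\<phi> T = 0"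
      by (simp_all add: \<phi>_def)
  qed
  have sin_prim: "((\<lambda>t. - cos (N * t) / N) has_real_derivative sin (N * t)) (at t)"
    "\<bar>- cos (N * t) / N\<bar> \<le> 1 / N" for t
    using N by (auto intro!: derivative_eq_intros simp: divide_right_mono)
  have cos_prim: "((\<lambda>t. sin (2 * N * t) / (2 * N)) has_real_derivative cos (2 * N * t)) (at t)"
    "\<bar>sin (2 * N * t) / (2 * N)\<bar> \<le> 1 / N" for t
    using N order_trans[OF abs_sin_le_one[of "N * (t * 2)"], of 2]
    by (auto intro!: derivative_eq_intros simp: field_simps)
  have osc: "norm (integral {0..t} (\<lambda>s. sin (N * s) *\<^sub>R h s)) \<le> D / N"
    "norm (integral {0..t} (\<lambda>s. cos (2 * N * s) *\<^sub>R f (\<xi> s))) \<le> D / N"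
    "norm (integral {0..t} \<phi>) \<le> D / N" if t: "t \<in> {0..T}" for t
  proof -
    note T0 = less_imp_le[OF T]
    show "norm (integral {0..t} (\<lambda>s. sin (N * s) *\<^sub>R h s)) \<le> D / N"
      using oscillating_integral[OF T0 h_deriv h_cont(2) bounds(1,2) sin_prim t]
      by (simp add: D_def)
    show "norm (integral {0..t} (\<lambda>s. cos (2 * N * s) *\<^sub>R f (\<xi> s))) \<le> D / N"
      using oscillating_integral[OF T0 k_deriv h_cont(3) bounds(3,4) cos_prim t]
      by (simp add: D_def)
    have "norm (integral {0..t} (\<lambda>s. sin (N * s) *\<^sub>R (sqrt 2 *\<^sub>R \<xi> s))) \<le> 1 / N * M * (2 + T)"
      by (rule oscillating_integral[OF T0 scaleR_deriv[OF \<xi>_deriv] _ _ _ sin_prim t])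
        (use bounds(5,6) in \<open>auto intro!: continuous_on_scaleR continuous_on_const cont\<close>)
    then show "norm (integral {0..t} \<phi>) \<le> D / N"
      by (simp add: D_def \<phi>_def mult.commute)
  qed
  have "\<exists>z. z 0 = y 0 \<and> (\<forall>t\<in>{0..T}. norm (z t - y t) \<le> C * (2 * D / N) \<and>
      (z has_vector_derivative \<eta> t - A (z t + \<phi> t) - f (z t + \<phi> t)) (at t within {0..T}))"
  proof (rule perturbed[OF y curves_continuous_on[OF \<phi>_curve] continuous_on_f[OF cont(1)]])
    fix t assume t: "t \<in> {0..T}"
    have "norm (\<phi> t) \<le> 1 * (sqrt 2 * norm (\<xi> t))"
      unfolding \<phi>_def by (auto simp: abs_mult mult.assoc intro!: mult_left_le_one_le)
    then show "norm (y t + \<phi> t) \<le> 2 * M"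
      using norm_triangle_ineq[of "y t" "\<phi> t"] bounds(5,7)[OF t] by linarith
    have sub: "{0..t} \<subseteq> {0..T}" using t by auto
    have "f (\<xi> s) - f (\<phi> s) - A (\<phi> s) - 2 *\<^sub>R \<Gamma> (y s) (\<phi> s) =
        sin (N * s) *\<^sub>R h s + cos (2 * N * s) *\<^sub>R f (\<xi> s)" for s
    proof -
      have "f (\<phi> s) = (1 - cos (2 * N * s)) *\<^sub>R f (\<xi> s)"
        unfolding \<phi>_def f_scale using cos_double_sin[of "N * s"]
        by (simp add: power_mult_distrib mult.assoc)
      then show ?thesis
        unfolding \<phi>_def h_def by (simp add: A_simps \<Gamma>_simps algebra_simps)
    qed
    then have "integral {0..t} (\<lambda>s. f (\<xi> s) - f (\<phi> s) - A (\<phi> s) - 2 *\<^sub>R \<Gamma> (y s) (\<phi> s)) =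
        integral {0..t} (\<lambda>s. sin (N * s) *\<^sub>R h s + cos (2 * N * s) *\<^sub>R f (\<xi> s))"
      by simp
    also have "\<dots> = integral {0..t} (\<lambda>s. sin (N * s) *\<^sub>R h s)
        + integral {0..t} (\<lambda>s. cos (2 * N * s) *\<^sub>R f (\<xi> s))"
      by (intro Henstock_Kurzweil_Integration.integral_add integrable_continuous_real
        continuous_on_scaleR continuous_on_f cont continuous_on_subset[OF h_cont(1) sub] continuous_intros)
    finally show "norm (integral {0..t} (\<lambda>s. f (\<xi> s) - f (\<phi> s) - A (\<phi> s) - 2 *\<^sub>R \<Gamma> (y s) (\<phi> s)))
        \<le> 2 * D / N"
      using osc(1,2)[OF t] norm_triangle_ineq[of "integral {0..t} (\<lambda>s. sin (N * s) *\<^sub>R h s)"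
        "integral {0..t} (\<lambda>s. cos (2 * N * s) *\<^sub>R f (\<xi> s))"] by simp
  next
    show "C * (2 * D / N) \<le> 1"
      using small m pieces by linarith
  qed
  then obtain z where z0: "z 0 = y 0"
    and z_near: "\<And>t. t \<in> {0..T} \<Longrightarrow> norm (z t - y t) \<le> C * (2 * D / N)"
    and z: "\<And>t. t \<in> {0..T} \<Longrightarrow>
      (z has_vector_derivative \<eta> t - A (z t + \<phi> t) - f (z t + \<phi> t)) (at t within {0..T})"
    by blast
  have z_cont: "continuous_on {0..T} z"
    using z by (meson continuous_on_eq_continuous_within has_vector_derivative_continuous)
  define x where "x = (\<lambda>t. z t + \<phi> t)"
  have "solves T (\<lambda>t. \<eta> t + \<phi>' t) x"
    unfolding solves_def
  proof
    fix t assume t: "t \<in> {0..T}"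
    have "(x has_vector_derivative (\<eta> t - A (z t + \<phi> t) - f (z t + \<phi> t)) + \<phi>' t) (at t within {0..T})"
      unfolding x_def
      by (intro has_vector_derivative_add z t has_vector_derivative_at_within[OF \<phi>'(2)])
    then show "(x has_vector_derivative \<eta> t + \<phi>' t - A (x t) - f (x t)) (at t within {0..T})"
      by (simp add: x_def algebra_simps)
  qed
  moreover have "x 0 = y 0"
    by (simp add: x_def z0 ends)
  moreover have "relax_close T \<epsilon> x y"
    unfolding relax_close_def
  proof (intro conjI ballI)
    have "norm (x T - y T) \<le> C * (2 * D / N)"
      unfolding x_def using z_near[of T] T by (simp add: ends)
    then show "norm (x T - y T) < \<epsilon>"
      using small m pieces by linarith
    fix t assume t: "t \<in> {0..T}"
    have sub: "{0..t} \<subseteq> {0..T}" using t by auto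
    have zy_cont: "continuous_on {0..t} (\<lambda>s. z s - y s)"
      by (intro continuous_on_diff continuous_on_subset[OF _ sub] z_cont cont)
    have "integral {0..t} (\<lambda>s. (z s - y s) + \<phi> s) =
        integral {0..t} (\<lambda>s. z s - y s) + integral {0..t} \<phi>"
      by (intro Henstock_Kurzweil_Integration.integral_add integrable_continuous_real zy_cont
        curves_continuous_on[OF \<phi>_curve])
    then have "integral {0..t} (\<lambda>s. x s - y s) = integral {0..t} (\<lambda>s. z s - y s) + integral {0..t} \<phi>"
      by (simp add: x_def algebra_simps)
    then have "norm (integral {0..t} (\<lambda>s. x s - y s)) \<le>
        norm (integral {0..t} (\<lambda>s. z s - y s)) + norm (integral {0..t} \<phi>)"
      by (simp add: norm_triangle_ineq)
    also have "norm (integral {0..t} (\<lambda>s. z s - y s)) \<le> C * (2 * D / N) * (t - 0)"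
      using t z_near sub by (intro integral_bound zy_cont) auto
    also have "\<dots> \<le> C * (2 * D / N) * T"
      using t pieces by (intro mult_left_mono) auto
    finally show "norm (integral {0..t} (\<lambda>s. x s - y s)) < \<epsilon>"
      using small m pieces osc(3)[OF t] by linarith
  qed
  ultimately show ?thesis
    using \<phi>'(1) by blast
qed

section \<open>Descending the chain of subspaces\<close>

text \<open>
  Right-hand sides whose solutions can be imitated by \<open>E\<close>-valued controls.  The solution \<open>y\<close> is
  assumed to exist, since blowup is not excluded; the imitating solution \<open>x\<close> has to exist on all
  of \<open>[0,T]\<close>.
\<close>

definition approximable :: "real \<Rightarrow> 'x set \<Rightarrow> (real \<Rightarrow> 'x) set"
  where "approximable T E = {\<eta>. \<forall>y \<epsilon>. solves T \<eta> y \<longrightarrow> 0 < \<epsilon> \<longrightarrow>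
    (\<exists>u\<in>curves E. \<exists>x. solves T u x \<and> x 0 = y 0 \<and> relax_close T \<epsilon> x y)}"

lemma approximableD:
  "\<eta> \<in> approximable T E \<Longrightarrow> solves T \<eta> y \<Longrightarrow> 0 < \<epsilon> \<Longrightarrow>
    \<exists>u\<in>curves E. \<exists>x. solves T u x \<and> x 0 = y 0 \<and> relax_close T \<epsilon> x y"
  unfolding approximable_def by blast

text \<open>
  Approximation can be iterated, as errors add up: it suffices to imitate \<open>\<eta>\<close> by right-hand sides that are
  themselves approximable.
\<close>

lemma approximable_closed:
  assumes "\<And>y \<epsilon>. solves T \<eta> y \<Longrightarrow> 0 < \<epsilon> \<Longrightarrow>
    \<exists>\<zeta>\<in>approximable T E. \<exists>z. solves T \<zeta> z \<and> z 0 = y 0 \<and> relax_close T \<epsilon> z y"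
  shows "\<eta> \<in> approximable T E"
  unfolding approximable_def
proof (intro CollectI allI impI)
  fix y \<epsilon> assume y: "solves T \<eta> y" and \<epsilon>: "(0::real) < \<epsilon>"
  obtain \<zeta> z where z: "\<zeta> \<in> approximable T E" "solves T \<zeta> z" "z 0 = y 0" "relax_close T (\<epsilon>/2) z y"
    using assms[OF y, of "\<epsilon>/2"] \<epsilon> by auto
  then obtain u x where x: "u \<in> curves E" "solves T u x" "x 0 = z 0" "relax_close T (\<epsilon>/2) x z"
    using approximableD[OF z(1,2), of "\<epsilon>/2"] \<epsilon> by auto
  have "relax_close T (\<epsilon>/2 + \<epsilon>/2) x y"
    using relax_close_trans[OF solves_continuous[OF x(2)] solves_continuous[OF z(2)]
      solves_continuous[OF y] x(4) z(4)] .
  with x z show "\<exists>u\<in>curves E. \<exists>x. solves T u x \<and> x 0 = y 0 \<and> relax_close T \<epsilon> x y"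
    by auto
qed

lemma curves_approximable: "\<eta> \<in> curves E \<Longrightarrow> \<eta> \<in> approximable T E"
proof -
  have "relax_close T \<epsilon> y y" if "0 < \<epsilon>" for \<epsilon> and y :: "real \<Rightarrow> 'x"
    using that by (simp add: relax_close_def)
  then show "\<eta> \<in> approximable T E" if "\<eta> \<in> curves E"
    using that unfolding approximable_def by blast
qed

text \<open>
  Curves of the form \<open>\<xi>\<^sub>0 - f(\<xi>\<^sub>1) - \<dots> - f(\<xi>\<^sub>p)\<close>, the time-dependent version of representability.
\<close>

inductive_set relaxed :: "'x set \<Rightarrow> (real \<Rightarrow> 'x) set" for E
  where
    curve: "\<eta> \<in> curves E \<Longrightarrow> \<eta> \<in> relaxed E"
  | minus_f: "\<eta> \<in> relaxed E \<Longrightarrow> \<xi> \<in> curves E \<Longrightarrow> (\<lambda>t. \<eta> t - f (\<xi> t)) \<in> relaxed E"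

lemma relaxed_continuous_on:
  assumes "\<eta> \<in> relaxed E"
  shows "continuous_on S \<eta>"
  using assms
proof induction
  case (minus_f \<eta> \<xi>)
  then show ?case
    by (intro continuous_on_diff continuous_on_f minus_f.IH curves_continuous_on[OF minus_f.hyps(2)])
qed (rule curves_continuous_on)

lemma relaxed_approximable:
  assumes T: "0 < T" and "0 \<in> E" and "\<eta> \<in> relaxed E"
  shows "\<eta> \<in> approximable T E"
proof -
  \<comment> \<open>Each relaxation step adds an \<open>E\<close>-valued term \<open>\<phi>'\<close> to the right-hand side; the induction
      hypothesis has to admit it.\<close>
  have "\<forall>\<zeta>\<in>curves E. (\<lambda>t. \<eta> t + \<zeta> t) \<in> approximable T E"
    using assms(3)
  proof induction
    case (curve \<eta>)
    then show ?case
      by (auto intro: curves_approximable curves.plus)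
  next
    case (minus_f \<eta> \<xi>)
    show ?case
    proof
      fix \<zeta> assume \<zeta>: "\<zeta> \<in> curves E"
      have cont: "continuous_on {0..T} (\<lambda>t. \<eta> t + \<zeta> t)"
        using relaxed_continuous_on[OF minus_f(1)] curves_continuous_on[OF \<zeta>]
        by (intro continuous_on_add)
      have "(\<lambda>t. (\<eta> t + \<zeta> t) - f (\<xi> t)) \<in> approximable T E"
      proof (rule approximable_closed)
        fix y and \<epsilon> :: real
        assume y: "solves T (\<lambda>t. (\<eta> t + \<zeta> t) - f (\<xi> t)) y" and \<epsilon>: "0 < \<epsilon>"
        obtain \<phi>' x where \<phi>': "\<phi>' \<in> curves E"
          and x: "solves T (\<lambda>t. \<eta> t + (\<zeta> t + \<phi>' t)) x" "x 0 = y 0" "relax_close T \<epsilon> x y"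
          using relaxation_step[OF T \<epsilon> cont minus_f.hyps(2) y] unfolding add.assoc by blast
        have "(\<lambda>t. \<eta> t + (\<zeta> t + \<phi>' t)) \<in> approximable T E"
          using bspec[OF minus_f.IH curves.plus[OF \<zeta> \<phi>']] .
        with x show "\<exists>\<theta>\<in>approximable T E. \<exists>z. solves T \<theta> z \<and> z 0 = y 0 \<and> relax_close T \<epsilon> z y"
          by (intro bexI exI conjI)
      qed
      then show "(\<lambda>t. (\<eta> t - f (\<xi> t)) + \<zeta> t) \<in> approximable T E"
        by (simp add: algebra_simps)
    qed
  qed
  moreover have "(\<lambda>t. 0 *\<^sub>R 0) \<in> curves E"
    by (intro curves.scale quasi_poly.const assms)
  ultimately have "(\<lambda>t. \<eta> t + 0 *\<^sub>R 0) \<in> approximable T E"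
    by (rule bspec)
  then show ?thesis
    by simp
qed

lemma relaxed_add:
  assumes "\<eta> \<in> relaxed E" "\<zeta> \<in> relaxed E"
  shows "(\<lambda>t. \<eta> t + \<zeta> t) \<in> relaxed E"
  using assms(2)
proof induction
  case (curve \<zeta>)
  show ?case
    using assms(1)
  proof induction
    case (curve \<eta>)
    then show ?case
      using \<open>\<zeta> \<in> curves E\<close> by (intro relaxed.curve curves.plus)
  next
    case (minus_f \<eta> \<xi>)
    then show ?case
      using relaxed.minus_f[OF minus_f.IH minus_f.hyps(2)] by (simp add: algebra_simps)
  qed
next
  case (minus_f \<zeta> \<xi>)
  then show ?case
    using relaxed.minus_f[OF minus_f.IH minus_f.hyps(2)] by (simp add: algebra_simps)
qed

text \<open>
  Since \<open>f(a \<xi>) = a\<^sup>2 f(\<xi>)\<close>, a squared coefficient can be moved into the arguments of \<open>f\<close>.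
\<close>

lemma relaxed_square_scale:
  assumes a: "a \<in> quasi_poly" and e: "representable f E e"
  shows "(\<lambda>t. (a t)\<^sup>2 *\<^sub>R e) \<in> relaxed E"
proof -
  obtain p :: nat and \<xi> where \<xi>: "\<And>i. i \<le> p \<Longrightarrow> \<xi> i \<in> E" and e_eq: "e = \<xi> 0 - (\<Sum>i=1..p. f (\<xi> i))"
    using e unfolding representable_def by blast
  have "(\<lambda>t. (a t)\<^sup>2 *\<^sub>R (\<xi> 0 - (\<Sum>i=1..m. f (\<xi> i)))) \<in> relaxed E" if "m \<le> p" for m
    using that
  proof (induction m)
    case 0
    then show ?case
      using curves.scale[OF quasi_poly.mult[OF a a] \<xi>[of 0]] relaxed.curve
      by (simp add: power2_eq_square)
  next
    case (Suc m)
    have "(\<lambda>t. a t *\<^sub>R \<xi> (Suc m)) \<in> curves E"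
      using Suc by (intro curves.scale a \<xi>)
    from relaxed.minus_f[OF Suc.IH this] Suc.prems show ?case
      by (simp add: f_scale algebra_simps)
  qed
  then show ?thesis
    unfolding e_eq by blast
qed

text \<open>
  Squares suffice because \<open>c = ((c + 1) / 2)\<^sup>2 - ((c - 1) / 2)\<^sup>2\<close> and because, \<open>\<F>(E)\<close> being a
  subspace, \<open>e\<close> and \<open>-e\<close> are both representable.
\<close>

lemma curves_script_F_relaxed:
  assumes E: "subspace E" and "\<eta> \<in> curves (script_F f E)"
  shows "\<eta> \<in> relaxed E"
  using assms(2)
proof induction
  case (scale c e)
  note F = script_F_greatest(1,2)[OF bilinear_\<Gamma> f_eq E]
  have e: "representable f E e" "representable f E (- e)"
    using scale(2) F(2) subspace_neg[OF F(1)] by auto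
  have qp: "(\<lambda>t. (1/2) * (c t + 1)) \<in> quasi_poly" "(\<lambda>t. (1/2) * (c t + (- 1))) \<in> quasi_poly"
    by (intro quasi_poly.mult quasi_poly.add quasi_poly.const scale(1))+
  have "(\<lambda>t. ((1/2) * (c t + 1))\<^sup>2 *\<^sub>R e + ((1/2) * (c t + (- 1)))\<^sup>2 *\<^sub>R (- e)) \<in> relaxed E"
    by (intro relaxed_add relaxed_square_scale qp e)
  moreover have "p\<^sup>2 *\<^sub>R e + q\<^sup>2 *\<^sub>R (- e) = (p\<^sup>2 - q\<^sup>2) *\<^sub>R e" for p q :: real
    by (simp add: scaleR_left_diff_distrib)
  moreover have "((1/2) * (r + 1))\<^sup>2 - ((1/2) * (r + (- 1)))\<^sup>2 = r" for r :: real
    by (simp add: power2_eq_square field_simps)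
  ultimately show ?case
    by (simp only:)
next
  case (plus g h)
  then show ?case
    by (intro relaxed_add)
qed

text \<open>
  One step down the chain for each index: a curve in \<open>\<F>(E\<^sub>n)\<close> is imitated by curves in \<open>E\<^sub>n\<close>, and
  these are imitated by curves in the range of \<open>B\<close>.
\<close>

lemma curves_E_space_approximable:
  assumes T: "0 < T" and B: "linear B" and "\<eta> \<in> curves (E_space f B n)"
  shows "\<eta> \<in> approximable T (range B)"
  using assms(3)
proof (induction n arbitrary: \<eta>)
  case 0
  then show ?case
    by (auto intro: curves_approximable)
next
  case (Suc n)
  have sub: "subspace (E_space f B n)"
    using B by (induction n)
      (auto intro: linear_subspace_image script_F_greatest(1)[OF bilinear_\<Gamma> f_eq])
  then have "\<eta> \<in> approximable T (E_space f B n)"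
    using Suc.prems by (intro relaxed_approximable[OF T subspace_0[OF sub]] curves_script_F_relaxed[OF sub]) auto
  show ?case
  proof (rule approximable_closed)
    fix y and \<epsilon> :: real assume "solves T \<eta> y" "0 < \<epsilon>"
    with \<open>\<eta> \<in> approximable T (E_space f B n)\<close>
    have "\<exists>\<zeta>\<in>curves (E_space f B n). \<exists>z. solves T \<zeta> z \<and> z 0 = y 0 \<and> relax_close T \<epsilon> z y"
      by (rule approximableD)
    then show "\<exists>\<zeta>\<in>approximable T (range B). \<exists>z. solves T \<zeta> z \<and> z 0 = y 0 \<and> relax_close T \<epsilon> z y"
      using Suc.IH by blast
  qed
qed

end

section \<open>The control problem\<close>

lemma relaxation_norm_le:
  fixes v :: "real \<Rightarrow> 'a::euclidean_space"
  assumes "0 \<le> \<tau>" "continuous_on {0..\<tau>} v"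
    and "\<And>t. t \<in> {0..\<tau>} \<Longrightarrow> norm (integral {0..t} v) \<le> c"
  shows "relaxation_norm \<tau> v \<le> c"
  unfolding relaxation_norm_def
proof (rule cSUP_least)
  show "{0..\<tau>} \<noteq> {}" using assms(1) by simp
  fix t assume t: "t \<in> {0..\<tau>}"
  then have "set_integrable lebesgue {0..t} v"
    by (intro absolutely_integrable_continuous_real continuous_on_subset[OF assms(2)]) auto
  then show "norm (LINT s:{0..t}|lebesgue. v s) \<le> c"
    using assms(3)[OF t] by (simp add: set_lebesgue_integral_eq_integral(2))
qed

theorem theorem3p5:
  fixes A :: "'x::euclidean_space \<Rightarrow> 'x"
    and B :: "'u::euclidean_space \<Rightarrow> 'x"
    and \<Gamma> :: "'x \<Rightarrow> 'x \<Rightarrow> 'x"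
    and f :: "'x \<Rightarrow> 'x"
    and \<tau> \<epsilon> :: real
    and \<psi> :: "real \<Rightarrow> 'x"
  assumes "linear A" and "linear B"
    and "bilinear \<Gamma>" and "\<And>x y. \<Gamma> x y = \<Gamma> y x"
    and "\<And>x. f x = \<Gamma> x x"
    and "\<exists>n\<^sub>X. E_space f B n\<^sub>X = UNIV"
    and "\<tau> > 0"
    and "\<psi> \<in> Sobolev_W12 {0<..<\<tau>}" and "continuous_on {0..\<tau>} \<psi>"
    and "\<epsilon> > 0"
  shows "\<exists>u :: real \<Rightarrow> 'u. C_infinity_on {0..\<tau>} u \<and>
           (\<exists>x. controlled_solution A f B \<tau> (\<psi> 0) u x) \<and>
           (\<forall>x. controlled_solution A f B \<tau> (\<psi> 0) u x \<longrightarrow>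
              norm (x \<tau> - \<psi> \<tau>) + relaxation_norm \<tau> (\<lambda>t. x t - \<psi> t) < \<epsilon>)"
proof -
  interpret quadratic_system A \<Gamma> f
    using assms(1,3,4,5) by (intro quadratic_system.intro)
  define \<delta> where "\<delta> = \<epsilon> / 8 / (1 + \<tau>)"
  have "1 + \<tau> \<noteq> 0"
    using assms(7) by simp
  then have "\<delta> * (1 + \<tau>) = \<epsilon> / 8"
    by (metis \<delta>_def nonzero_eq_divide_eq)
  moreover have "2 * \<delta> + 2 * \<delta> * \<tau> = 2 * (\<delta> * (1 + \<tau>))"
    by (simp add: algebra_simps)
  ultimately have \<delta>: "0 < \<delta>" "2 * \<delta> + 2 * \<delta> * \<tau> = \<epsilon> / 4"
    using assms(7,10) by (simp add: \<delta>_def, linarith)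
  obtain g where "polynomial_function g" and g: "\<And>t. t \<in> {0..\<tau>} \<Longrightarrow> norm (\<psi> t - g t) < \<delta>"
    using Stone_Weierstrass_polynomial_function[OF compact_Icc assms(9) \<delta>(1)] by blast
  \<comment> \<open>The polynomial is shifted to have the prescribed initial value.\<close>
  define y where "y = (\<lambda>t. g t + 1 *\<^sub>R (\<psi> 0 - g 0))"
  have y: "y \<in> curves UNIV"
    unfolding y_def
    by (intro curves.plus curves.scale quasi_poly.const polynomial_function_curve) (fact | simp)+
  have y_near: "norm (y t - \<psi> t) \<le> 2 * \<delta>" if "t \<in> {0..\<tau>}" for t
  proof -
    have "norm (y t - \<psi> t) = norm ((\<psi> 0 - g 0) - (\<psi> t - g t))"
      by (simp add: y_def algebra_simps)
    also have "\<dots> \<le> norm (\<psi> 0 - g 0) + norm (\<psi> t - g t)"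
      by (rule norm_triangle_ineq4)
    also have "\<dots> \<le> \<delta> + \<delta>"
      using g[of 0] g[OF that] assms(7) by (intro add_mono) auto
    finally show ?thesis by simp
  qed
  obtain y' where y': "y' \<in> curves UNIV" "\<And>t. (y has_vector_derivative y' t) (at t)"
    using curves_deriv[OF y] by blast
  define \<eta> where "\<eta> = (\<lambda>t. y' t + A (y t) + f (y t))"
  have "\<eta> \<in> curves UNIV"
    unfolding \<eta>_def f_eq
    using curves_mono[OF subset_UNIV curves_image_linear[OF linear_A y]]
    by (intro curves.plus y' curves_bilinear[OF bilinear_\<Gamma>] y)
  then have "\<eta> \<in> approximable \<tau> (range B)"
    using assms(6) curves_E_space_approximable[OF assms(7,2)] by metis
  moreover have "solves \<tau> \<eta> y"
    unfolding solves_def \<eta>_def using y'(2) by (auto intro: has_vector_derivative_at_within)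
  ultimately have "\<exists>v\<in>curves (range B). \<exists>x. solves \<tau> v x \<and> x 0 = y 0 \<and> relax_close \<tau> (\<epsilon>/4) x y"
    using assms(10) by (intro approximableD) auto
  then obtain v x where v: "v \<in> curves (range B)"
    and x: "solves \<tau> v x" "x 0 = y 0" "relax_close \<tau> (\<epsilon>/4) x y"
    by blast
  obtain u where u: "u \<in> curves UNIV" "v = (\<lambda>t. B (u t))"
    using curves_range_lift[OF assms(2) v] by blast
  have sol_iff: "controlled_solution A f B \<tau> (\<psi> 0) u x \<longleftrightarrow> solves \<tau> v x \<and> x 0 = \<psi> 0" for x
  proof -
    have "x' + A (x t) + f (x t) = B (u t) \<longleftrightarrow> x' = v t - A (x t) - f (x t)" for x' t
      by (auto simp: u(2) algebra_simps)
    then show ?thesis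
      unfolding controlled_solution_def solves_def by auto
  qed
  have x0: "x 0 = \<psi> 0"
    using x(2) by (simp add: y_def)
  have "norm (w \<tau> - \<psi> \<tau>) + relaxation_norm \<tau> (\<lambda>t. w t - \<psi> t) < \<epsilon>"
    if "controlled_solution A f B \<tau> (\<psi> 0) u w" for w
  proof -
    have w: "solves \<tau> v w" "w 0 = \<psi> 0"
      using that sol_iff by auto
    have w_eq: "w t = x t" if "t \<in> {0..\<tau>}" for t
      using solves_unique[OF w(1) x(1) _ that] w(2) x0 by simp
    have w_cont: "continuous_on {0..\<tau>} w"
      using solves_continuous[OF w(1)] .
    have "norm (w \<tau> - \<psi> \<tau>) \<le> norm (x \<tau> - y \<tau>) + norm (y \<tau> - \<psi> \<tau>)"
      using norm_triangle_ineq[of "x \<tau> - y \<tau>" "y \<tau> - \<psi> \<tau>"] w_eq[of \<tau>] assms(7) by simp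
    then have "norm (w \<tau> - \<psi> \<tau>) < \<epsilon>/4 + 2 * \<delta>"
      using x(3) y_near[of \<tau>] assms(7) by (auto simp: relax_close_def)
    moreover have "relaxation_norm \<tau> (\<lambda>t. w t - \<psi> t) \<le> \<epsilon>/4 + 2 * \<delta> * \<tau>"
    proof (rule relaxation_norm_le)
      show "0 \<le> \<tau>" using assms(7) by simp
      show "continuous_on {0..\<tau>} (\<lambda>t. w t - \<psi> t)"
        by (intro continuous_on_diff w_cont assms(9))
      fix t assume t: "t \<in> {0..\<tau>}"
      have sub: "{0..t} \<subseteq> {0..\<tau>}" using t by auto
      have cont: "continuous_on {0..t} (\<lambda>s. x s - y s)" "continuous_on {0..t} (\<lambda>s. y s - \<psi> s)"
        by (intro continuous_on_diff continuous_on_subset[OF _ sub] solves_continuous[OF x(1)]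
          curves_continuous_on[OF y] assms(9))+
      have "integral {0..t} (\<lambda>s. w s - \<psi> s) = integral {0..t} (\<lambda>s. (x s - y s) + (y s - \<psi> s))"
        using w_eq sub by (intro integral_cong) auto
      also have "\<dots> = integral {0..t} (\<lambda>s. x s - y s) + integral {0..t} (\<lambda>s. y s - \<psi> s)"
        by (intro Henstock_Kurzweil_Integration.integral_add integrable_continuous_real cont)
      finally have "norm (integral {0..t} (\<lambda>s. w s - \<psi> s)) \<le>
          norm (integral {0..t} (\<lambda>s. x s - y s)) + norm (integral {0..t} (\<lambda>s. y s - \<psi> s))"
        by (simp add: norm_triangle_ineq)
      also have "norm (integral {0..t} (\<lambda>s. y s - \<psi> s)) \<le> 2 * \<delta> * (t - 0)"
        using t y_near sub by (intro integral_bound cont) auto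
      also have "\<dots> \<le> 2 * \<delta> * \<tau>"
        using t \<delta> by (intro mult_left_mono) auto
      finally show "norm (integral {0..t} (\<lambda>s. w s - \<psi> s)) \<le> \<epsilon>/4 + 2 * \<delta> * \<tau>"
        using x(3) t by (force simp: relax_close_def)
    qed
    ultimately show ?thesis
      using \<delta> assms(10) by linarith
  qed
  moreover have "C_infinity_on {0..\<tau>} u"
    using u(1) by (rule curves_C_infinity)
  moreover have "controlled_solution A f B \<tau> (\<psi> 0) u x"
    using sol_iff x(1) x0 by blast
  ultimately show ?thesis
    by blast
qed

end
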